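(* Let $D$ be an infinite division ring and let $N\subseteq D^\times$ be a finite index normal subgroup containing $-1$. Assume that $D^\times/N$ supports a V-graph $\Delta$. Then: (1) if $\mathrm{diam}(\Delta)\ge 3$, then $N$ admits a strongly leveled map; (2) if $\mathrm{diam}(\Delta)\ge 4$, then $N$ admits a strong valuation-like map; (3) if $\mathrm{diam}(\Delta)\ge 5$, then $N$ admits a strong valuation-like map of s-level $0$. Furthermore, in each of the three cases the map $\varphi$ can be taken such that, if $D$ is finite-dimensional over a subfield $k\subseteq F=Z(D)$, then $N_{\ge 0}=\{x\in N\mid \varphi(x)\ge 0\}$ contains a basis of $D$ over $k$.
   Context: V-graphs. Let $D$ be an infinite division ring and $N$ a proper normal subgroup of finite index in $D^\times$ containing $-1$; for $a\in D^\times$ write $a^*=aN\in D^\times/N$. Consider undirected graphs $\Delta$ whose vertices are the non-identity elements of $D^\times/N$; $d(\cdot,\cdot)$ is the distance function on vertices, with $d(a^*,b^* )=\infty$ if $a^*,b^*$ lie in different connected components, and $\mathrm{diam}(\Delta)=\sup d(a^*,b^* )$. Such a $\Delta$ is a V-graph associated with $N$ (and $D^\times/N$ supports the V-graph $\Delta$) if for all $a,b,c\in D^\times\setminus N$: (V1) if $a-b\in N$ then $d(a^*,b^* )\le 1$; (V2) if $d(a^*,b^* )\le 1$ then $d((a^{-1})^*,b^* )\le 1$; (V3) if $ab\notin N$ and both $d(a^*,c^* )\le 1$ and $d(a^*b^*,c^* )\le 1$, then $d(b^*,c^* )\le 1$. Leveled maps. A partially ordered group is a group $\Gamma$ (written additively,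 not necessarily commutative) with a partial order such that $\alpha\le\gamma$ and $\beta\le\delta$ imply $\alpha+\beta\le\gamma+\delta$. For a homomorphism $\varphi\colon N\to\Gamma$ and $\alpha\in\Gamma$ put $N_{>\alpha}=\{x\in N\mid\varphi(x)>\alpha\}$, and similarly $N_{\le\alpha}$, $N_{\ge\alpha}$, $N_{<\alpha}$. The homomorphism $\varphi$ is a strongly leveled map if there is $\alpha\in\Gamma$ with $\alpha\ge 0$ (called an s-level of $\varphi$) such that $N_{>\alpha}\neq\emptyset$ and $1\pm N_{>\alpha}\subseteq N_{\le 0}$. A strong valuation-like map is a strongly leveled map to a totally ordered group. *)

theory Defs
  imports
    "HOL-Algebra.Embedded_Algebras"
    "HOL-Algebra.Algebraic_Closure_Type"
    "HOL-Library.Extended_Nat"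
begin

section \<open>Multiplicative group and centre of a division ring\<close>

text \<open>A division ring is a type of class \<open>division_ring\<close>; \<open>ring_of_type_algebra\<close> is the record
  of the ring structure on the whole type.\<close>

definition mult_grp :: "'a::division_ring monoid" where
  "mult_grp = units_of (ring_of_type_algebra :: 'a ring)"

definition ring_center :: "'a::ring_1 set" where
  "ring_center = {z. \<forall>x. z * x = x * z}"

lemma ring_ring_of_type_algebra: "ring (ring_of_type_algebra :: 'a::ring_1 ring)"
proof -
  have "\<exists>y. x + y = 0" for x :: 'a
    using add.right_inverse by blast
  then show ?thesis
    unfolding ring_of_type_algebra_def using add.right_inverse
    by unfold_locales (auto simp: algebra_simps Units_def)
qed

lemma carrier_mult_grp: "carrier (mult_grp :: 'a::division_ring monoid) = UNIV - {0}"
  unfolding mult_grp_def units_of_carrier ring_of_type_algebra_def Units_def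
  by auto (metis left_inverse right_inverse)

lemma mult_mult_grp [simp]: "x \<otimes>\<^bsub>mult_grp\<^esub> y = x * y"
  by (simp add: mult_grp_def units_of_mult ring_of_type_algebra_def)

lemma one_mult_grp [simp]: "\<one>\<^bsub>mult_grp\<^esub> = 1"
  by (simp add: mult_grp_def units_of_one ring_of_type_algebra_def)

lemma group_mult_grp: "group (mult_grp :: 'a::division_ring monoid)"
  unfolding mult_grp_def
  by (intro monoid.units_group ring.is_monoid ring_ring_of_type_algebra)


section \<open>Distance and diameter\<close>

text \<open>A graph is given by its adjacency relation. The distance is the least length of a walk,
  and it is \<open>\<infinity>\<close> if there is none, since the infimum of the empty set in \<open>enat\<close> is \<open>\<infinity>\<close>.\<close>

definition gdist :: "'v rel \<Rightarrow> 'v \<Rightarrow> 'v \<Rightarrow> enat" where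
  "gdist E u v = (INF n \<in> {n. (u, v) \<in> E ^^ n}. enat n)"

definition gdiam :: "'v set \<Rightarrow> 'v rel \<Rightarrow> enat" where
  "gdiam V E = (SUP (u, v) \<in> V \<times> V. gdist E u v)"


section \<open>V-graphs\<close>

abbreviation quot :: "'a::division_ring set \<Rightarrow> 'a set monoid" where
  "quot N \<equiv> mult_grp Mod N"

abbreviation star :: "'a::division_ring set \<Rightarrow> 'a \<Rightarrow> 'a set" where
  "star N a \<equiv> a <#\<^bsub>mult_grp\<^esub> N"

text \<open>The library builds the quotient group from right cosets; left and right cosets agree since
  \<open>N\<close> is normal.\<close>

definition V_verts :: "'a::division_ring set \<Rightarrow> 'a set set" where
  "V_verts N = carrier (quot N) - {\<one>\<^bsub>quot N\<^esub>}"

text \<open>Irreflexivity is not required of the adjacency relation: loops do not affect distances.\<close>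

definition V_graph :: "'a::division_ring set \<Rightarrow> 'a set rel \<Rightarrow> bool" where
  "V_graph N \<Delta> \<longleftrightarrow>
     infinite (UNIV :: 'a set) \<and>
     N \<lhd> mult_grp \<and> N \<noteq> carrier mult_grp \<and> finite (carrier (quot N)) \<and> - 1 \<in> N \<and>
     \<Delta> \<subseteq> V_verts N \<times> V_verts N \<and> sym \<Delta> \<and>
     (\<forall>a \<in> carrier mult_grp - N. \<forall>b \<in> carrier mult_grp - N.
        a - b \<in> N \<longrightarrow> gdist \<Delta> (star N a) (star N b) \<le> 1) \<and>
     (\<forall>a \<in> carrier mult_grp - N. \<forall>b \<in> carrier mult_grp - N.
        gdist \<Delta> (star N a) (star N b) \<le> 1 \<longrightarrow>
        gdist \<Delta> (star N (inverse a)) (star N b) \<le> 1) \<and>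
     (\<forall>a \<in> carrier mult_grp - N. \<forall>b \<in> carrier mult_grp - N. \<forall>c \<in> carrier mult_grp - N.
        a * b \<notin> N \<and> gdist \<Delta> (star N a) (star N c) \<le> 1 \<and>
        gdist \<Delta> (star N a \<otimes>\<^bsub>quot N\<^esub> star N b) (star N c) \<le> 1 \<longrightarrow>
        gdist \<Delta> (star N b) (star N c) \<le> 1)"

definition V_diam :: "'a::division_ring set \<Rightarrow> 'a set rel \<Rightarrow> enat" where
  "V_diam N \<Delta> = gdiam (V_verts N) \<Delta>"


section \<open>Leveled maps\<close>

text \<open>The group \<open>\<Gamma>\<close> is written multiplicatively, as always in HOL-Algebra: \<open>\<otimes>\<close> and \<open>\<one>\<close> are the
  addition and the zero of the additive notation. It need not be commutative.\<close>

record 'g ordered_monoid = "'g monoid" +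
  ord_rel :: "'g rel"

definition po_group :: "('g, 'm) ordered_monoid_scheme \<Rightarrow> bool" where
  "po_group \<Gamma> \<longleftrightarrow> group \<Gamma> \<and> partial_order_on (carrier \<Gamma>) (ord_rel \<Gamma>) \<and>
     (\<forall>\<alpha> \<beta> \<gamma> \<delta>. (\<alpha>, \<gamma>) \<in> ord_rel \<Gamma> \<and> (\<beta>, \<delta>) \<in> ord_rel \<Gamma> \<longrightarrow>
        (\<alpha> \<otimes>\<^bsub>\<Gamma>\<^esub> \<beta>, \<gamma> \<otimes>\<^bsub>\<Gamma>\<^esub> \<delta>) \<in> ord_rel \<Gamma>)"

definition N_ge :: "'a set \<Rightarrow> ('g, 'm) ordered_monoid_scheme \<Rightarrow> ('a \<Rightarrow> 'g) \<Rightarrow> 'g \<Rightarrow> 'a set" where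
  "N_ge N \<Gamma> \<phi> \<alpha> = {x \<in> N. (\<alpha>, \<phi> x) \<in> ord_rel \<Gamma>}"

definition N_le :: "'a set \<Rightarrow> ('g, 'm) ordered_monoid_scheme \<Rightarrow> ('a \<Rightarrow> 'g) \<Rightarrow> 'g \<Rightarrow> 'a set" where
  "N_le N \<Gamma> \<phi> \<alpha> = {x \<in> N. (\<phi> x, \<alpha>) \<in> ord_rel \<Gamma>}"

definition N_gt :: "'a set \<Rightarrow> ('g, 'm) ordered_monoid_scheme \<Rightarrow> ('a \<Rightarrow> 'g) \<Rightarrow> 'g \<Rightarrow> 'a set" where
  "N_gt N \<Gamma> \<phi> \<alpha> = {x \<in> N. (\<alpha>, \<phi> x) \<in> ord_rel \<Gamma> \<and> \<phi> x \<noteq> \<alpha>}"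

definition s_level ::
  "'a::division_ring set \<Rightarrow> ('g, 'm) ordered_monoid_scheme \<Rightarrow> ('a \<Rightarrow> 'g) \<Rightarrow> 'g \<Rightarrow> bool" where
  "s_level N \<Gamma> \<phi> \<alpha> \<longleftrightarrow> \<alpha> \<in> carrier \<Gamma> \<and> (\<one>\<^bsub>\<Gamma>\<^esub>, \<alpha>) \<in> ord_rel \<Gamma> \<and> N_gt N \<Gamma> \<phi> \<alpha> \<noteq> {} \<and>
     (\<forall>x \<in> N_gt N \<Gamma> \<phi> \<alpha>. 1 + x \<in> N_le N \<Gamma> \<phi> \<one>\<^bsub>\<Gamma>\<^esub> \<and> 1 - x \<in> N_le N \<Gamma> \<phi> \<one>\<^bsub>\<Gamma>\<^esub>)"

definition strongly_leveled_map ::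
  "'a::division_ring set \<Rightarrow> ('g, 'm) ordered_monoid_scheme \<Rightarrow> ('a \<Rightarrow> 'g) \<Rightarrow> bool" where
  "strongly_leveled_map N \<Gamma> \<phi> \<longleftrightarrow> po_group \<Gamma> \<and> \<phi> \<in> hom (mult_grp\<lparr>carrier := N\<rparr>) \<Gamma> \<and>
     (\<exists>\<alpha>. s_level N \<Gamma> \<phi> \<alpha>)"

definition strong_valuation_like_map ::
  "'a::division_ring set \<Rightarrow> ('g, 'm) ordered_monoid_scheme \<Rightarrow> ('a \<Rightarrow> 'g) \<Rightarrow> bool" where
  "strong_valuation_like_map N \<Gamma> \<phi> \<longleftrightarrow> strongly_leveled_map N \<Gamma> \<phi> \<and>
     linear_order_on (carrier \<Gamma>) (ord_rel \<Gamma>)"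


section \<open>Bases over central subfields\<close>

definition contains_basis_over :: "'a::division_ring set \<Rightarrow> 'a set \<Rightarrow> bool" where
  "contains_basis_over S k \<longleftrightarrow> (\<exists>us. set us \<subseteq> S \<and>
     ring.independent ring_of_type_algebra k us \<and> ring.Span ring_of_type_algebra k us = UNIV)"

definition basis_property ::
  "'a::division_ring set \<Rightarrow> ('g, 'm) ordered_monoid_scheme \<Rightarrow> ('a \<Rightarrow> 'g) \<Rightarrow> bool" where
  "basis_property N \<Gamma> \<phi> \<longleftrightarrow>
     (\<forall>k. subfield k (ring_of_type_algebra :: 'a ring) \<and> k \<subseteq> ring_center \<and>
        ring.finite_dimension (ring_of_type_algebra :: 'a ring) k UNIV \<longrightarrow>
        contains_basis_over (N_ge N \<Gamma> \<phi> \<one>\<^bsub>\<Gamma>\<^esub>) k)"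

text \<open>In an existence claim over \<open>\<Gamma>\<close> one type for its elements has to be chosen. For a map defined
  on \<open>N \<subseteq> 'a\<close> the type \<open>'a set\<close> loses nothing: if \<open>\<alpha>\<close> is an s-level, then \<open>\<Gamma>\<close> can be replaced by
  its subgroup generated by \<open>\<phi> ` N\<close> and \<open>\<alpha>\<close>, whose cardinality is at most that of the infinite
  type \<open>'a\<close>.\<close>

end

theory Submission
  imports Defs
begin

text \<open>Write \<open>N(z) = {n \<in> N. n + z \<in> N}\<close> and order \<open>N\<close> by the normal submonoid
  \<open>Q\<^sub>x = {t \<in> N. N(x)t \<subseteq> N(x)}\<close> of elements that are at most \<open>0\<close>. For every finite \<open>F \<subseteq> D\<close> some
  \<open>m \<in> N\<close> satisfies \<open>m + F \<subseteq> N\<close>, by Gallai's theorem for the colouring of \<open>D\<close> by the cosets of \<open>N\<close>.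
  Hence there are elements that are as small or as large as one wants compared with finitely many
  cosets. For \<open>xN\<close> and \<open>yN\<close> at distance at least \<open>3\<close>, a sum that is not in \<open>N\<close>, but is adjacent to
  both by (V1), is impossible. Splitting \<open>1 + n\<close> and \<open>1 + n + c\<close> suitably, this shows that \<open>1 + n\<close> is in
  \<open>Q\<^sub>x\<close> for all \<open>n \<in> N\<close> above some level, so that \<open>Q\<^sub>x\<close> defines a strongly leveled map.
  At distance at least \<open>4\<close> one has \<open>N = Q\<^sub>y \<union> - inverse Q\<^sub>x\<close>, and \<open>\<plusminus> Q\<^sub>x Q\<^sub>y\<close>, which lies in \<open>Q\<^sub>x\<close> up to
  a bounded factor, defines a total order. At distance at least \<open>5\<close>, if \<open>t\<close> is neither in \<open>Q\<^sub>x\<close> nor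
  in \<open>Q\<^sub>y\<close>, then \<open>1 - t\<close> is adjacent to neighbours of \<open>xN\<close> and of \<open>yN\<close> unless it is in \<open>N\<close>; so the
  level can be taken to be \<open>0\<close>.\<close>

section \<open>Monochromatic homothetic copies\<close>

text \<open>Induction on the number \<open>r\<close> of differently coloured homothets of
  \<open>F\<close> with a common focus \<open>w\<close>. The colours on a translate of a finite
  window form one colour of a product colouring, to which the homothety theorem for \<open>F\<close>
  applies. Either the focus takes an old colour, or its colour gives one more homothet.\<close>

lemma colour_focusing:
  fixes F :: "'a::division_ring set"
  assumes fin: "finite F" and ne: "F \<noteq> {}"
    and hom: "\<And>C B. finite C \<Longrightarrow> finite B \<Longrightarrow> \<exists>S. finite S \<and> (\<forall>(t, l)\<in>S. l \<notin> B) \<and>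
      (\<forall>c::'a \<Rightarrow> nat. range c \<subseteq> C \<longrightarrow> (\<exists>t l. (t, l) \<in> S \<and> (\<forall>f\<in>F. \<forall>g\<in>F. c (t + l * f) = c (t + l * g))))"
    and "finite C" "finite B"
  shows "\<exists>W L. finite W \<and> finite L \<and> L \<inter> B = {} \<and>
    (\<forall>c::'a \<Rightarrow> nat. range c \<subseteq> C \<longrightarrow>
       (\<exists>t\<in>W. \<exists>l\<in>L. \<forall>f\<in>F. c (t + l * f) = c t) \<or>
       (\<exists>w\<in>W. \<exists>K\<subseteq>C. card K = r \<and> (\<forall>k\<in>K. \<exists>l\<in>L. \<forall>f\<in>F. c (w + l * f) = k)))"
proof (induction r)
  case 0
  show ?case
    by (rule exI[of _ "{0}"], rule exI[of _ "{}"]) auto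
next
  case (Suc r)
  then obtain W L where WL: "finite W" "finite L" "L \<inter> B = {}"
    and IH: "\<And>c::'a \<Rightarrow> nat. range c \<subseteq> C \<Longrightarrow>
       (\<exists>t\<in>W. \<exists>l\<in>L. \<forall>f\<in>F. c (t + l * f) = c t) \<or>
       (\<exists>w\<in>W. \<exists>K\<subseteq>C. card K = r \<and> (\<forall>k\<in>K. \<exists>l\<in>L. \<forall>f\<in>F. c (w + l * f) = k))"
    by blast
  define Pts where "Pts = W \<union> (\<lambda>(w, l, f). w + l * f) ` (W \<times> L \<times> F)"
  have "finite Pts" using WL fin unfolding Pts_def by blast
  then obtain xs where xs: "set xs = Pts" using finite_list by blast
  \<comment> \<open>Colours are natural numbers, so the list of colours on a translate of
    \<open>Pts\<close> is coded by a number.\<close>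
  define C' where "C' = list_encode ` {ys. set ys \<subseteq> C \<and> length ys = length xs}"
  have "finite C'" unfolding C'_def using finite_lists_length_eq[OF \<open>finite C\<close>] by blast
  define B' where "B' = B \<union> (\<lambda>(b, l). b - l) ` (B \<times> L)"
  have "finite B'" unfolding B'_def using WL \<open>finite B\<close> by blast
  obtain S where S: "finite S" "\<And>t l. (t, l) \<in> S \<Longrightarrow> l \<notin> B'"
    "\<And>c::'a \<Rightarrow> nat. range c \<subseteq> C' \<Longrightarrow> \<exists>t l. (t, l) \<in> S \<and> (\<forall>f\<in>F. \<forall>g\<in>F. c (t + l * f) = c (t + l * g))"
    using hom[OF \<open>finite C'\<close> \<open>finite B'\<close>] by fastforce
  define W' where "W' = (\<lambda>((s, m), f, w). s + m * f + w) ` (S \<times> insert 0 F \<times> W)"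
  define L' where "L' = L \<union> snd ` S \<union> (\<lambda>((s, m), l). m + l) ` (S \<times> L)"
  have finW: "finite W'" unfolding W'_def using S(1) WL(1) fin by blast
  have finL: "finite L'" unfolding L'_def using S(1) WL(2) by blast
  have LB: "L' \<inter> B = {}"
  proof -
    have False if "m + l \<in> B" "(s, m) \<in> S" "l \<in> L" for s m l
    proof -
      have "m = (m + l) - l" by simp
      then have "m \<in> B'" unfolding B'_def using that by (intro UnI2 image_eqI[of _ _ "(m + l, l)"]) auto
      then show False using S(2) that by blast
    qed
    moreover have False if "m \<in> B" "(s, m) \<in> S" for s m
      using S(2)[OF that(2)] that(1) unfolding B'_def by blast
    ultimately show ?thesis using WL(3) unfolding L'_def
      by (auto simp: disjoint_iff)
  qed
  have "(\<exists>t\<in>W'. \<exists>l\<in>L'. \<forall>f\<in>F. c (t + l * f) = c t) \<or>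
       (\<exists>w\<in>W'. \<exists>K\<subseteq>C. card K = Suc r \<and> (\<forall>k\<in>K. \<exists>l\<in>L'. \<forall>f\<in>F. c (w + l * f) = k))"
    if c: "range c \<subseteq> C" for c :: "'a \<Rightarrow> nat"
  proof -
    define c' where "c' = (\<lambda>t. list_encode (map (\<lambda>x. c (t + x)) xs))"
    have "range c' \<subseteq> C'" 
    proof
      fix z assume "z \<in> range c'"
      then obtain t where t: "z = list_encode (map (\<lambda>x. c (t + x)) xs)" unfolding c'_def by blast
      have "set (map (\<lambda>x. c (t + x)) xs) \<subseteq> C \<and> length (map (\<lambda>x. c (t + x)) xs) = length xs"
        using c by (simp add: image_subset_iff)
      then show "z \<in> C'" unfolding C'_def t by (intro imageI CollectI)
    qed
    from S(3)[OF this] obtain s m where sm: "(s, m) \<in> S"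
      "\<And>f g. f \<in> F \<Longrightarrow> g \<in> F \<Longrightarrow> c' (s + m * f) = c' (s + m * g)"
      by blast
    have eq: "c (s + m * f + x) = c (s + m * g + x)" if "f \<in> F" "g \<in> F" "x \<in> Pts" for f g x
    proof -
      have "map (\<lambda>x. c (s + m * f + x)) xs = map (\<lambda>x. c (s + m * g + x)) xs"
        using sm(2)[OF that(1,2)] unfolding c'_def list_encode_eq by assumption
      then show ?thesis using that(3) unfolding xs[symmetric] map_eq_conv by blast
    qed
    obtain f0 where f0: "f0 \<in> F" using ne by blast
    \<comment> \<open>The windows at all \<open>s + m * f\<close> look alike. The induction
      hypothesis is applied in the one at \<open>f0\<close>, and its homothets are then spread over
      the others.\<close>
    define d where "d = (\<lambda>y. c (s + m * f0 + y))"
    have "range d \<subseteq> C" using c unfolding d_def by blast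
    from IH[OF this] show ?thesis
    proof (elim disjE bexE exE conjE)
      fix t l assume tl: "t \<in> W" "l \<in> L" "\<forall>f\<in>F. d (t + l * f) = d t"
      have "s + m * f0 + t \<in> W'" unfolding W'_def using sm f0 tl by force
      moreover have "l \<in> L'" using tl unfolding L'_def by blast
      moreover have "\<forall>f\<in>F. c (s + m * f0 + t + l * f) = c (s + m * f0 + t)"
        using tl(3) unfolding d_def by (simp add: add.assoc)
      ultimately show ?thesis by blast
    next
      fix w K assume w: "w \<in> W" and K: "K \<subseteq> C" "card K = r"
        and Kl: "\<forall>k\<in>K. \<exists>l\<in>L. \<forall>f\<in>F. d (w + l * f) = k"
      show ?thesis
      proof (cases "d w \<in> K")
        case True
        then obtain l where l: "l \<in> L" "\<forall>f\<in>F. d (w + l * f) = d w" using Kl by blast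
        have "s + m * f0 + w \<in> W'" unfolding W'_def using sm f0 w by force
        moreover have "l \<in> L'" using l unfolding L'_def by blast
        moreover have "\<forall>f\<in>F. c (s + m * f0 + w + l * f) = c (s + m * f0 + w)"
          using l(2) unfolding d_def by (simp add: add.assoc)
        ultimately show ?thesis by blast
      next
        case False
        have "d w \<in> C" using \<open>range d \<subseteq> C\<close> by blast
        have "finite K" using K(1) \<open>finite C\<close> finite_subset by blast
        have "s + w \<in> W'" unfolding W'_def using sm w
          by (intro image_eqI[of _ _ "((s, m), 0, w)"]) auto
        moreover have "insert (d w) K \<subseteq> C" using K \<open>d w \<in> C\<close> by blast
        moreover have "card (insert (d w) K) = Suc r" using False K \<open>finite K\<close> by simp
        moreover have "\<forall>k\<in>insert (d w) K. \<exists>l\<in>L'. \<forall>f\<in>F. c (s + w + l * f) = k"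
        proof
          fix k assume "k \<in> insert (d w) K"
          then consider "k = d w" | "k \<in> K" by blast
          then show "\<exists>l\<in>L'. \<forall>f\<in>F. c (s + w + l * f) = k"
          proof cases
            case 1
            have "m \<in> L'" unfolding L'_def using sm(1) by force
            moreover have "c (s + w + m * f) = k" if "f \<in> F" for f
            proof -
              have "s + w + m * f = s + m * f + w" by (simp add: algebra_simps)
              moreover have "w \<in> Pts" unfolding Pts_def using w by blast
              ultimately show ?thesis using eq[OF that f0] 1 unfolding d_def by metis
            qed
            ultimately show ?thesis by blast
          next
            case 2
            then obtain l where l: "l \<in> L" "\<forall>f\<in>F. d (w + l * f) = k" using Kl by blast
            \<comment> \<open>The point of index \<open>f\<close> is taken in the window at
              \<open>s + m * f\<close>, so the two ratios add up.\<close>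
            have "m + l \<in> L'" unfolding L'_def using sm(1) l(1) by force
            moreover have "c (s + w + (m + l) * f) = k" if "f \<in> F" for f
            proof -
              have "s + w + (m + l) * f = s + m * f + (w + l * f)" by (simp add: algebra_simps)
              moreover have "w + l * f \<in> Pts" unfolding Pts_def using w l(1) that by force
              ultimately show ?thesis using eq[OF that f0] l(2) that unfolding d_def by metis
            qed
            ultimately show ?thesis by blast
          qed
        qed
        ultimately show ?thesis by blast
      qed
    qed
  qed
  then show ?case using finW finL LB by blast
qed

text \<open>Gallai's theorem with homothety ratios in \<open>D\<close>. The finite set \<open>S\<close> does not depend on the
  colouring; this is what allows the induction to pass to product colourings.\<close>

lemma monochromatic_homothets:
  fixes F :: "'a::division_ring set"
  assumes inf: "infinite (UNIV :: 'a set)" and "finite F"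
    and "finite C" "finite B"
  shows "\<exists>S. finite S \<and> (\<forall>(t, l)\<in>S. l \<notin> B) \<and>
      (\<forall>c::'a \<Rightarrow> nat. range c \<subseteq> C \<longrightarrow> (\<exists>t l. (t, l) \<in> S \<and> (\<forall>f\<in>F. \<forall>g\<in>F. c (t + l * f) = c (t + l * g))))"
  using assms(2-4)
proof (induction "card F" arbitrary: F C B)
  case 0
  obtain l where "l \<notin> B" using ex_new_if_finite[OF inf 0(4)] by blast
  with 0 show ?case by (intro exI[of _ "{(0, l)}"]) auto
next
  case (Suc n)
  obtain f0 F0 where F0: "F = insert f0 F0" "f0 \<notin> F0" "finite F0" "card F0 = n"
    using Suc(2,3) by (metis card_Suc_eq_finite)
  \<comment> \<open>Translation moves \<open>f0\<close> to \<open>0\<close>, which becomes the focus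
    of the homothets of \<open>H\<close>.\<close>
  define H where "H = (\<lambda>f. f - f0) ` F0"
  have H: "finite H" "card H = n" unfolding H_def using F0 by (auto simp: card_image inj_on_def)
  show ?case
  proof (cases "H = {}")
    case True
    then have "F = {f0}" using F0 unfolding H_def by simp
    obtain l where "l \<notin> B" using ex_new_if_finite[OF inf Suc.prems(3)] by blast
    with \<open>F = {f0}\<close> show ?thesis by (intro exI[of _ "{(0, l)}"]) auto
  next
    case False
    obtain W L where WL: "finite W" "finite L" "L \<inter> B = {}"
      and mono: "\<And>c::'a \<Rightarrow> nat. range c \<subseteq> C \<Longrightarrow>
       (\<exists>t\<in>W. \<exists>l\<in>L. \<forall>f\<in>H. c (t + l * f) = c t) \<or>
       (\<exists>w\<in>W. \<exists>K\<subseteq>C. card K = Suc (card C) \<and> (\<forall>k\<in>K. \<exists>l\<in>L. \<forall>f\<in>H. c (w + l * f) = k))"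
      using colour_focusing[OF H(1) False Suc(1)[OF H(2)[symmetric] H(1)] Suc(4,5), of "Suc (card C)"]
      by blast
    have small: "\<not> (K \<subseteq> C \<and> card K = Suc (card C))" for K
      using card_mono[OF Suc(4), of K] by auto
    define S where "S = (\<lambda>(t, l). (t - l * f0, l)) ` (W \<times> L)"
    have "\<exists>t l. (t, l) \<in> S \<and> (\<forall>f\<in>F. \<forall>g\<in>F. c (t + l * f) = c (t + l * g))" if c: "range c \<subseteq> C" for c :: "'a \<Rightarrow> nat"
    proof -
      obtain t l where tl: "t \<in> W" "l \<in> L" "\<And>f. f \<in> H \<Longrightarrow> c (t + l * f) = c t"
        using mono[OF c] small by meson
      have "c ((t - l * f0) + l * f) = c t" if "f \<in> F" for f
      proof (cases "f = f0")
        case False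
        then have "c (t + l * (f - f0)) = c t" using that F0 tl(3) unfolding H_def by blast
        then show ?thesis by (simp add: algebra_simps)
      qed simp
      moreover have "(t - l * f0, l) \<in> S" unfolding S_def using tl by force
      ultimately show ?thesis by (intro exI[of _ "t - l * f0"] exI[of _ l]) simp
    qed
    moreover have "finite S" "\<forall>(t, l)\<in>S. l \<notin> B" unfolding S_def using WL by auto
    ultimately show ?thesis by blast
  qed
qed

section \<open>Normal subgroups of finite index\<close>

locale finite_index_normal =
  fixes N :: "'a::division_ring set"
  assumes inf: "infinite (UNIV :: 'a set)"
    and one_N: "1 \<in> N" and zero_N: "0 \<notin> N"
    and mult_N: "m \<in> N \<Longrightarrow> n \<in> N \<Longrightarrow> m * n \<in> N"
    and inverse_N: "n \<in> N \<Longrightarrow> inverse n \<in> N"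
    and conj_N: "g \<noteq> 0 \<Longrightarrow> n \<in> N \<Longrightarrow> g * n * inverse g \<in> N"
    and minus_one_N: "- 1 \<in> N"
    and finite_index: "\<exists>R. finite R \<and> 0 \<notin> R \<and> (\<forall>g. g \<noteq> 0 \<longrightarrow> (\<exists>r\<in>R. inverse r * g \<in> N))"
begin

lemma nonzero_N: "n \<in> N \<Longrightarrow> n \<noteq> 0"
  using zero_N by blast

lemma minus_N: "n \<in> N \<Longrightarrow> - n \<in> N"
  using mult_N[OF minus_one_N] by fastforce

lemma minus_N_iff: "- n \<in> N \<longleftrightarrow> n \<in> N"
  using minus_N[of n] minus_N[of "- n"] by auto

lemma conj_N': "g \<noteq> 0 \<Longrightarrow> n \<in> N \<Longrightarrow> inverse g * n * g \<in> N"
  using conj_N[of "inverse g" n] by simp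

lemma mult_right_N_iff: "n \<in> N \<Longrightarrow> g * n \<in> N \<longleftrightarrow> g \<in> N"
  using mult_N[OF _ inverse_N, of "g * n" n] mult_N[of g n] nonzero_N[of n]
  by (auto simp: mult.assoc)

text \<open>Colour \<open>D\<close> by the cosets of \<open>N\<close>. Adding all \<open>r * f\<close> with coset representatives \<open>r\<close> to the
  pattern makes up for the unknown coset of the homothety ratio.\<close>

theorem N_thick:
  assumes "finite F"
  obtains m where "m \<in> N" "\<And>f. f \<in> F \<Longrightarrow> m + f \<in> N"
proof -
  obtain R where R: "finite R" "0 \<notin> R" "\<And>g. g \<noteq> 0 \<Longrightarrow> \<exists>r\<in>R. inverse r * g \<in> N"
    using finite_index by blast
  define rep where "rep = (\<lambda>g. SOME r. r \<in> R \<and> inverse r * g \<in> N)"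
  have rep: "rep g \<in> R" "inverse (rep g) * g \<in> N" if "g \<noteq> 0" for g
    using someI_ex[of "\<lambda>r. r \<in> R \<and> inverse r * g \<in> N"] R(3)[OF that] unfolding rep_def by blast+
  obtain h :: "'a \<Rightarrow> nat" where h: "inj_on h R"
    using R(1) finite_imp_inj_to_nat_seg by metis
  \<comment> \<open>The colour \<open>0\<close> is reserved for \<open>d = 0\<close>, which lies in
    no coset. A pattern containing \<open>0\<close> and \<open>1\<close> cannot have this colour, as
    \<open>l\<close> is not \<open>0\<close>.\<close>
  define c where "c = (\<lambda>d. if d = 0 then 0 else Suc (h (rep d)))"
  define F' where "F' = {0, 1} \<union> (\<lambda>(r, f). r * f) ` (R \<times> F)"
  have "finite F'" unfolding F'_def using R(1) assms by blast
  then obtain S where S: "\<And>t l. (t, l) \<in> S \<Longrightarrow> l \<noteq> 0"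
    "\<And>c::'a \<Rightarrow> nat. range c \<subseteq> insert 0 (Suc ` h ` R) \<Longrightarrow>
       \<exists>t l. (t, l) \<in> S \<and> (\<forall>f\<in>F'. \<forall>g\<in>F'. c (t + l * f) = c (t + l * g))"
    using monochromatic_homothets[OF inf, of F' "insert 0 (Suc ` h ` R)" "{0}"] R(1) by fastforce
  have "range c \<subseteq> insert 0 (Suc ` h ` R)" unfolding c_def using rep(1) by auto
  from S(2)[OF this] obtain t l where "(t, l) \<in> S"
    and mono: "\<And>f g. f \<in> F' \<Longrightarrow> g \<in> F' \<Longrightarrow> c (t + l * f) = c (t + l * g)" by blast
  then have "l \<noteq> 0" using S(1) by blast
  have F'01: "0 \<in> F'" "1 \<in> F'" unfolding F'_def by auto
  have "c (t + l * 0) \<noteq> 0"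
  proof
    assume *: "c (t + l * 0) = 0"
    then have "c (t + l * 1) = 0" using mono F'01 by metis
    then have "t + l = 0" "t = 0" using * unfolding c_def by (auto split: if_splits)
    then show False using \<open>l \<noteq> 0\<close> by simp
  qed
  then have "t \<noteq> 0" unfolding c_def by auto
  define r where "r = rep t"
  have r: "r \<in> R" "r \<noteq> 0" "inverse r * t \<in> N" unfolding r_def using rep[OF \<open>t \<noteq> 0\<close>] R(2) by auto
  have col: "inverse r * (t + l * f) \<in> N" if "f \<in> F'" for f
  proof -
    have "c (t + l * f) = c t" using mono[OF that F'01(1)] by simp
    then have "t + l * f \<noteq> 0" "h (rep (t + l * f)) = h r"
      unfolding c_def r_def using \<open>t \<noteq> 0\<close> by (auto split: if_splits)
    then have "rep (t + l * f) = r" using h r(1) rep(1) by (meson inj_onD)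
    then show ?thesis using rep(2)[OF \<open>t + l * f \<noteq> 0\<close>] by simp
  qed
  \<comment> \<open>\<open>inverse k * inverse l\<close> carries the coset of \<open>r\<close> into
    \<open>N\<close>; at the point of index \<open>k * f\<close> it produces a translate by exactly
    \<open>f\<close>.\<close>
  obtain k where k: "k \<in> R" "inverse k * (inverse l * r) \<in> N"
    using R(3)[of "inverse l * r"] \<open>l \<noteq> 0\<close> r(2) by auto
  have "k \<noteq> 0" using k R(2) by blast
  have key: "inverse k * inverse l * (t + l * f) \<in> N" if "f \<in> F'" for f
  proof -
    have "inverse k * inverse l * (t + l * f) = (inverse k * (inverse l * r)) * (inverse r * (t + l * f))"
      using r(2) by (metis (no_types, opaque_lifting) mult.assoc mult.right_neutral right_inverse mult_1)
    then show ?thesis using mult_N[OF k(2) col[OF that]] by simp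
  qed
  show thesis
  proof
    show "inverse k * inverse l * t \<in> N" using key[OF F'01(1)] by simp
    fix f assume "f \<in> F"
    then have "k * f \<in> F'" unfolding F'_def using k(1) by force
    from key[OF this] show "inverse k * inverse l * t + f \<in> N"
      using \<open>l \<noteq> 0\<close> \<open>k \<noteq> 0\<close> by (simp add: distrib_left mult.assoc)
        (simp add: mult.assoc[symmetric])
  qed
qed

section \<open>Cosets of \<open>N\<close> and their cones\<close>

definition outside :: "'a \<Rightarrow> bool" where
  "outside a \<longleftrightarrow> a \<noteq> 0 \<and> a \<notin> N"

definition lcos :: "'a \<Rightarrow> 'a set" where
  "lcos z = (*) z ` N"

text \<open>For a coset \<open>Z = zN\<close> this is the set of all \<open>t\<close> with \<open>N(z)t \<subseteq> N(z)\<close>, where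
  \<open>N(z) = {n \<in> N. n + z \<in> N}\<close>; it consists of the elements that are at most \<open>0\<close>
  for the order attached to \<open>zN\<close>.\<close>

definition cone :: "'a set \<Rightarrow> 'a set" where
  "cone Z = {t \<in> N. \<forall>c\<in>Z. 1 + c \<in> N \<longrightarrow> t + c \<in> N}"

lemma outside_add: "outside c \<Longrightarrow> n \<in> N \<Longrightarrow> c + n \<notin> N \<Longrightarrow> outside (c + n)"
  unfolding outside_def using minus_N by (metis add_eq_0_iff2)

lemma outside_add': "outside c \<Longrightarrow> n \<in> N \<Longrightarrow> n + c \<notin> N \<Longrightarrow> outside (n + c)"
  using outside_add by (simp add: add.commute)

lemma lcos_self: "z \<in> lcos z"
  unfolding lcos_def using one_N by force

lemma lcos_right: "c \<in> lcos z \<Longrightarrow> n \<in> N \<Longrightarrow> c * n \<in> lcos z"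
  unfolding lcos_def by (auto simp: mult.assoc intro!: imageI mult_N)

lemma lcos_left: "z \<noteq> 0 \<Longrightarrow> c \<in> lcos z \<Longrightarrow> n \<in> N \<Longrightarrow> n * c \<in> lcos z"
proof -
  assume z: "z \<noteq> 0" and c: "c \<in> lcos z" and n: "n \<in> N"
  have "n * z = z * (inverse z * n * z)" using z by (simp add: mult.assoc[symmetric])
  moreover have "inverse z * n * z \<in> N" using conj_N'[OF z n] .
  ultimately have "n * z \<in> lcos z" unfolding lcos_def by (metis image_eqI)
  moreover obtain m where "m \<in> N" "c = z * m" using c unfolding lcos_def by blast
  ultimately show "n * c \<in> lcos z" using lcos_right by (metis mult.assoc)
qed

lemma lcos_minus: "c \<in> lcos z \<Longrightarrow> - c \<in> lcos z"
  using lcos_right[OF _ minus_one_N] by fastforce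

lemma lcos_outside: "outside z \<Longrightarrow> c \<in> lcos z \<Longrightarrow> outside c"
  unfolding outside_def lcos_def using mult_right_N_iff nonzero_N by auto

lemma lcos_sum_N: "z \<in> lcos w \<Longrightarrow> z \<noteq> 0 \<Longrightarrow> m + inverse z * d \<in> N \<Longrightarrow> z * m + d \<in> lcos w"
proof -
  assume "z \<in> lcos w" "z \<noteq> 0" "m + inverse z * d \<in> N"
  then have "z * (m + inverse z * d) \<in> lcos w" using lcos_right by blast
  then show ?thesis using \<open>z \<noteq> 0\<close> by (simp add: distrib_left mult.assoc[symmetric])
qed

lemma cone_subset: "cone Z \<subseteq> N"
  unfolding cone_def by blast

lemma cone_one: "1 \<in> cone Z"
  unfolding cone_def using one_N by blast

text \<open>Dividing by \<open>m\<close> on the left extends the condition on \<open>1 + c\<close>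
  in \<open>cone\<close> to \<open>m + c\<close>, because a coset of a normal subgroup is closed
  under left multiplication by \<open>N\<close>.\<close>

lemma cone_scale_left:
  assumes z: "z \<noteq> 0" and t: "t \<in> cone (lcos z)" and m: "m \<in> N" and c: "c \<in> lcos z" "m + c \<in> N"
  shows "m * t + c \<in> N"
proof -
  have m0: "m \<noteq> 0" using m zero_N by blast
  have "inverse m * (m + c) \<in> N" using mult_N[OF inverse_N[OF m] c(2)] .
  then have "1 + inverse m * c \<in> N" using m0 by (simp add: distrib_left)
  moreover have "inverse m * c \<in> lcos z" using lcos_left[OF z c(1) inverse_N[OF m]] .
  ultimately have "t + inverse m * c \<in> N" using t unfolding cone_def by blast
  from mult_N[OF m this] show ?thesis using m0 by (simp add: distrib_left mult.assoc[symmetric])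
qed

lemma cone_mult:
  assumes z: "z \<noteq> 0" and "s \<in> cone (lcos z)" "t \<in> cone (lcos z)"
  shows "s * t \<in> cone (lcos z)"
proof -
  have "s * t + c \<in> N" if "c \<in> lcos z" "1 + c \<in> N" for c
    using cone_scale_left[OF z assms(3), of s c] assms(2) that unfolding cone_def by blast
  moreover have "s * t \<in> N" using assms cone_subset mult_N by blast
  ultimately show ?thesis unfolding cone_def by blast
qed

lemma cone_conj:
  assumes z: "z \<noteq> 0" and u: "u \<in> N" and t: "t \<in> cone (lcos z)"
  shows "u * t * inverse u \<in> cone (lcos z)"
proof -
  have u0: "u \<noteq> 0" using u zero_N by blast
  have "u * t * inverse u + c \<in> N" if c: "c \<in> lcos z" "1 + c \<in> N" for c
  proof -
    have *: "(u + c * u) \<in> N" using mult_N[OF c(2) u] by (simp add: distrib_right)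
    have "u * t + c * u \<in> N" using cone_scale_left[OF z t u lcos_right[OF c(1) u] *] .
    from mult_N[OF this inverse_N[OF u]] show ?thesis using u0 by (simp add: distrib_right mult.assoc)
  qed
  moreover have "u * t * inverse u \<in> N" using conj_N[OF u0] t cone_subset by blast
  ultimately show ?thesis unfolding cone_def by blast
qed

section \<open>Elements of cosets with prescribed sums, from thickness\<close>

lemma coset_witness_one_minus:
  assumes "outside z"
  obtains c where "c \<in> lcos z" "1 - c \<in> lcos z"
proof -
  have z0: "z \<noteq> 0" using assms unfolding outside_def by simp
  obtain m where m: "m \<in> N" "m + - inverse z \<in> N" using N_thick[of "{- inverse z}"] by auto
  have "z * m + - 1 \<in> lcos z" using lcos_sum_N[OF lcos_self z0, of m "- 1"] m(2) by simp
  then have "1 - z * m \<in> lcos z" using lcos_minus[of "z * m + - 1"] by simp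
  moreover have "z * m \<in> lcos z" using m(1) unfolding lcos_def by blast
  ultimately show thesis using that by blast
qed

lemma coset_witness_add:
  assumes "z \<noteq> 0"
  obtains c where "c \<in> lcos z" "c + d \<in> lcos z"
proof -
  obtain m where m: "m \<in> N" "m + inverse z * d \<in> N" using N_thick[of "{inverse z * d}"] by auto
  have "z * m + d \<in> lcos z" using lcos_sum_N[OF lcos_self assms m(2)] .
  moreover have "z * m \<in> lcos z" using m(1) unfolding lcos_def by blast
  ultimately show thesis using that by blast
qed

lemma coset_witness_one_plus:
  obtains k where "k \<in> N" "1 + z * k \<in> N"
proof -
  obtain m where m: "m \<in> N" "m + z \<in> N" using N_thick[of "{z}"] by auto
  have "m \<noteq> 0" using m zero_N by blast
  have "(m + z) * inverse m \<in> N" using mult_N[OF m(2) inverse_N[OF m(1)]] .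
  then have "1 + z * inverse m \<in> N" using \<open>m \<noteq> 0\<close> by (simp add: distrib_right)
  then show thesis using that inverse_N[OF m(1)] by blast
qed

end

section \<open>Cosets at distance at least three\<close>

text \<open>\<open>A a b\<close> stands for distance at most \<open>1\<close> between the cosets of
  \<open>a\<close> and \<open>b\<close>; the graph axioms can then be used on elements of
  \<open>D\<close>.\<close>

locale near_relation = finite_index_normal N for N :: "'a::division_ring set" +
  fixes A :: "'a \<Rightarrow> 'a \<Rightarrow> bool"
  assumes A_refl: "outside a \<Longrightarrow> A a a"
    and A_sym: "A a b \<Longrightarrow> A b a"
    and A_coset: "A a b \<Longrightarrow> n \<in> N \<Longrightarrow> A (a * n) b"
    and V1: "outside a \<Longrightarrow> outside b \<Longrightarrow> a - b \<in> N \<Longrightarrow> A a b"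
    and V2: "outside a \<Longrightarrow> outside b \<Longrightarrow> A a b \<Longrightarrow> A (inverse a) b"
    and V3: "outside a \<Longrightarrow> outside b \<Longrightarrow> outside c \<Longrightarrow> a * b \<notin> N \<Longrightarrow> A a c \<Longrightarrow> A (a * b) c \<Longrightarrow> A b c"
begin

lemma A_lcos:
  assumes "A a b" "c \<in> lcos z" "a \<in> lcos z" "z \<noteq> 0"
  shows "A c b"
proof -
  obtain m n where mn: "m \<in> N" "n \<in> N" "a = z * m" "c = z * n"
    using assms unfolding lcos_def by blast
  have "c = a * (inverse m * n)"
    using mn nonzero_N[OF mn(1)] by (simp add: mult.assoc) (simp add: mult.assoc[symmetric])
  then show ?thesis using A_coset[OF assms(1)] mult_N[OF inverse_N] mn by metis
qed

lemma A_sum: "outside c \<Longrightarrow> outside d \<Longrightarrow> c + d \<in> N \<Longrightarrow> A c d"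
proof -
  assume *: "outside c" "outside d" "c + d \<in> N"
  then have "outside (- d)" unfolding outside_def using minus_N_iff by auto
  then have "A (- d) c" using V1[of c "- d"] * A_sym by simp
  from A_coset[OF this minus_one_N] show "A c d" using A_sym by simp
qed

lemma A_add: "outside c \<Longrightarrow> n \<in> N \<Longrightarrow> c + n \<notin> N \<Longrightarrow> A (c + n) c"
  using V1[of "c + n" c] outside_add[of c n] by simp

lemma A_add': "outside c \<Longrightarrow> n \<in> N \<Longrightarrow> n + c \<notin> N \<Longrightarrow> A (n + c) c"
  using A_add[of c n] by (simp add: add.commute)

end

text \<open>As \<open>A\<close> is reflexive on elements outside \<open>N\<close>,
  \<open>far3\<close> also excludes walks shorter than two.\<close>

locale far_pair = near_relation N A for N :: "'a::division_ring set" and A +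
  fixes x y :: 'a
  assumes outside_x: "outside x" and outside_y: "outside y"
    and far3: "outside c \<Longrightarrow> A x c \<Longrightarrow> A c y \<Longrightarrow> False"
begin

lemma x0: "x \<noteq> 0" and y0: "y \<noteq> 0"
  using outside_x outside_y unfolding outside_def by auto

lemma far3': "a \<in> lcos x \<Longrightarrow> b \<in> lcos y \<Longrightarrow> outside c \<Longrightarrow> A c a \<Longrightarrow> A c b \<Longrightarrow> False"
  using far3[of c] A_lcos[of a c x x] A_lcos[of b c y y] A_sym lcos_self x0 y0 by blast

lemma swap: "far_pair N A y x"
  by unfold_locales (use outside_x outside_y far3 A_sym in blast)+

text \<open>Otherwise \<open>m + a + b\<close> differs from \<open>a\<close> by \<open>m + b\<close>
  and from \<open>b\<close> by \<open>m + a\<close>, so it is near both.\<close>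

lemma sum_N:
  assumes a: "a \<in> lcos x" and b: "b \<in> lcos y" and "m + a \<in> N" "m + b \<in> N"
  shows "m + a + b \<in> N"
proof (rule ccontr)
  assume n: "m + a + b \<notin> N"
  have oa: "outside a" and ob: "outside b" using lcos_outside[OF outside_x a] lcos_outside[OF outside_y b] by auto
  have "A (m + a + b) b" using A_add'[OF ob assms(3) n] .
  moreover have eq: "m + a + b = m + b + a" by (simp add: algebra_simps)
  then have "A (m + a + b) a" using A_add'[OF oa assms(4)] n by (simp only: simp_thms)
  moreover have "outside (m + a + b)" using outside_add'[OF ob assms(3) n] .
  ultimately show False using far3'[OF a b] by blast
qed

text \<open>Here \<open>m + a\<close> itself would be near both: its difference with
  \<open>a\<close> and its sum with \<open>b\<close> lie in \<open>N\<close>.\<close>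

lemma sum_ND:
  assumes a: "a \<in> lcos x" and b: "b \<in> lcos y" and m: "m \<in> N" and "m + a + b \<in> N"
  shows "m + a \<in> N"
proof (rule ccontr)
  assume n: "m + a \<notin> N"
  have oa: "outside a" and ob: "outside b" using lcos_outside[OF outside_x a] lcos_outside[OF outside_y b] by auto
  have o: "outside (m + a)" using outside_add'[OF oa m n] .
  show False using far3'[OF a b o A_add'[OF oa m n] A_sum[OF o ob assms(4)]] .
qed

lemma sum_ND':
  assumes a: "a \<in> lcos x" and b: "b \<in> lcos y" and m: "m \<in> N" and "m + a + b \<in> N"
  shows "m + b \<in> N"
proof -
  interpret sw: far_pair N A y x by (rule swap)
  show ?thesis using sw.sum_ND[OF b a m] assms(4) by (simp add: algebra_simps)
qed

text \<open>Outside \<open>N\<close>, the element \<open>m + a + b\<close> would be near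
  \<open>a + b\<close> and near \<open>b\<close>, which now represent the two far vertices. The
  second conclusion says that \<open>b\<close> is smaller than \<open>a\<close>: any
  \<open>m\<close> that absorbs \<open>a\<close> absorbs \<open>b\<close>.\<close>

lemma absorb:
  assumes a: "a \<in> lcos x" and b: "b \<in> lcos y" and ab: "a + b \<in> lcos x" and m: "m \<in> N" and "m + a \<in> N"
  shows "m + a + b \<in> N" and "m + b \<in> N"
proof -
  show *: "m + a + b \<in> N"
  proof (rule ccontr)
    assume n: "m + a + b \<notin> N"
    have ob: "outside b" and oab: "outside (a + b)" using lcos_outside[OF outside_x ab] lcos_outside[OF outside_y b] by auto
    have "A (m + a + b) b" using A_add'[OF ob assms(5) n] .
    moreover have "A (m + a + b) (a + b)" using A_add'[OF oab m] n by (simp add: add.assoc)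
    moreover have "outside (m + a + b)" using outside_add'[OF ob assms(5) n] .
    ultimately show False using far3'[OF ab b] by blast
  qed
  show "m + b \<in> N" using sum_ND'[OF a b m *] .
qed

text \<open>\<open>s\<close> represents the quotient of the two vertices; by normality, right
  multiplication by it carries the coset of \<open>x\<close> into that of \<open>y\<close>.\<close>

lemma mult_quotient: "x * s \<in> lcos y \<Longrightarrow> a \<in> lcos x \<Longrightarrow> a * s \<in> lcos y"
proof -
  assume s: "x * s \<in> lcos y" and a: "a \<in> lcos x"
  then obtain n where n: "n \<in> N" "a = x * n" unfolding lcos_def by blast
  have "a * s = (x * n * inverse x) * (x * s)" using n(2) x0 by (simp add: mult.assoc) (simp add: mult.assoc[symmetric])
  then show ?thesis using lcos_left[OF y0 s conj_N[OF x0 n(1)]] by simp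
qed

lemma one_plus_quotient:
  assumes s: "x * s \<in> lcos y" and u: "1 + s \<in> N"
  shows "1 + s \<in> cone (lcos x)"
proof -
  have u0: "1 + s \<noteq> 0" using u zero_N by metis
  have "1 + s + c \<in> N" if c: "c \<in> lcos x" "1 + c \<in> N" for c
  proof -
    define a where "a = c * inverse (1 + s)"
    have a: "a \<in> lcos x" unfolding a_def using lcos_right[OF c(1) inverse_N[OF u]] .
    have ca: "c = a * (1 + s)" unfolding a_def using u0 by (simp add: mult.assoc)
    have "1 + a + a * s \<in> N" using c(2) unfolding ca by (simp add: distrib_left add.assoc)
    then have "1 + a \<in> N" using sum_ND[OF a mult_quotient[OF s a] one_N] by blast
    from mult_N[OF this u] show ?thesis unfolding ca by (simp add: distrib_right)
  qed
  then show ?thesis unfolding cone_def using u by blast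
qed

lemma quotient_smaller:
  assumes s: "x * s \<in> lcos y" and u: "1 + s \<in> N" and a: "a \<in> lcos x" and m: "m \<in> N" "m + a \<in> N"
  shows "m + a * s \<in> N"
proof -
  have "a + a * s \<in> lcos x" using lcos_right[OF a u] by (simp add: distrib_left)
  then show ?thesis using absorb(2)[OF a mult_quotient[OF s a] _ m] by blast
qed

text \<open>A converse to \<open>quotient_smaller\<close> up to the factor \<open>k\<close>: the
  choice of \<open>k\<close> puts \<open>a * s * k + a * n\<close> into the coset of
  \<open>y\<close>, so \<open>absorb\<close> applies with \<open>x\<close> and \<open>y\<close>
  exchanged.\<close>

lemma quotient_larger:
  assumes s: "x * s \<in> lcos y" and k: "k + inverse s * n \<in> N" "k \<in> N" "n \<in> N"
    and a: "a \<in> lcos x" and m: "m \<in> N" "m + a * s \<in> N"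
  shows "m * k + a * n \<in> N"
proof -
  interpret sw: far_pair N A y x by (rule swap)
  have b: "a * s \<in> lcos y" using mult_quotient[OF s a] .
  have s0: "s \<noteq> 0" using lcos_outside[OF outside_y b] unfolding outside_def by auto
  have 1: "a * s * k \<in> lcos y" using lcos_right[OF b k(2)] .
  have 2: "a * n \<in> lcos x" using lcos_right[OF a k(3)] .
  have "a * s * (k + inverse s * n) \<in> lcos y" using lcos_right[OF b k(1)] .
  also have "a * s * (k + inverse s * n) = a * s * k + a * (s * inverse s) * n"
    by (simp add: distrib_left mult.assoc)
  finally have 3: "a * s * k + a * n \<in> lcos y" using s0 by simp
  have 4: "m * k + a * s * k \<in> N" using mult_N[OF m(2) k(2)] by (simp add: distrib_right)
  show ?thesis using sw.absorb(2)[OF 1 2 3 mult_N[OF m(1) k(2)] 4] .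
qed

text \<open>\<open>1 + m\<close> is both \<open>(m + a) + (1 - a)\<close> and
  \<open>(m + b) + (1 - b)\<close>, so outside \<open>N\<close> it would be near
  \<open>1 - a\<close> and \<open>1 - b\<close>.\<close>

lemma one_plus_inverse_N:
  assumes m: "m \<in> N" and a: "1 - a \<in> lcos x" "m + a \<in> N" and b: "1 - b \<in> lcos y" "m + b \<in> N"
  shows "1 + inverse m \<in> N"
proof -
  have "1 + m \<in> N"
  proof (rule ccontr)
    assume n: "1 + m \<notin> N"
    have oa: "outside (1 - a)" and ob: "outside (1 - b)" using lcos_outside[OF outside_x a(1)] lcos_outside[OF outside_y b(1)] by auto
    have eq: "m + a + (1 - a) = 1 + m" "m + b + (1 - b) = 1 + m" by (auto simp: algebra_simps)
    have "A (1 + m) (1 - a)" "outside (1 + m)" using A_add'[OF oa a(2)] outside_add'[OF oa a(2)] n unfolding eq by auto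
    moreover have "A (1 + m) (1 - b)" using A_add'[OF ob b(2)] n unfolding eq by auto
    ultimately show False using far3'[OF a(1) b(1)] by blast
  qed
  from mult_N[OF inverse_N[OF m] this] show ?thesis
    using nonzero_N[OF m] by (simp add: distrib_left add.commute)
qed

text \<open>This improves membership in \<open>N\<close> to membership in the cone. With
  \<open>n = inverse (k * q)\<close>, \<open>p = 1 + n\<close> and \<open>c = a * p\<close>, it
  suffices that \<open>1 + a = 1 + c - a * n\<close> lies in \<open>N\<close>; this is reached from
  \<open>1 + c\<close> by way of \<open>a * s\<close>.\<close>

lemma one_plus_small_cone:
  assumes s: "x * s \<in> lcos y" "1 + s \<in> N"
    and N1: "\<And>q. q \<in> cone (lcos x) \<Longrightarrow> 1 + inverse (k * q) \<in> N"
    and k: "k \<in> N" "k - inverse s \<in> N"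
    and q: "q \<in> cone (lcos x)"
  shows "1 + inverse (k * q) \<in> cone (lcos x)"
proof -
  have qN: "q \<in> N" using q cone_subset by blast
  have k0: "k \<noteq> 0" and q0: "q \<noteq> 0" using k(1) qN zero_N by auto
  define n where "n = inverse (k * q)"
  define p where "p = 1 + n"
  have n: "n \<in> N" unfolding n_def using inverse_N mult_N k(1) qN by blast
  have p: "p \<in> N" unfolding p_def n_def using N1[OF q] .
  have p0: "p \<noteq> 0" using p zero_N by blast
  have u0: "1 + s \<noteq> 0" using s(2) zero_N by metis
  have "p + c \<in> N" if c: "c \<in> lcos x" "1 + c \<in> N" for c
  proof -
    \<comment> \<open>\<open>q * (1 + s)\<close> is in the cone too; multiplying \<open>N1\<close>
      for it by \<open>1 + s\<close> yields \<open>p + s \<in> N\<close>.\<close>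
    have "1 + inverse (k * (q * (1 + s))) \<in> N"
      using N1[OF cone_mult[OF x0 q one_plus_quotient[OF s]]] .
    from mult_N[OF s(2) this] have "1 + s + (1 + s) * inverse (k * (q * (1 + s))) \<in> N"
      by (simp only: distrib_left mult_1_right)
    moreover have "(1 + s) * inverse (k * (q * (1 + s))) = n"
      unfolding n_def using k0 q0 u0
      by (simp add: nonzero_inverse_mult_distrib mult.assoc[symmetric])
    ultimately have ps: "p + s \<in> N" unfolding p_def by (simp add: algebra_simps)
    define a where "a = c * inverse p"
    have ap: "a * p = c" unfolding a_def using p0 by (simp add: mult.assoc)
    have a: "a \<in> lcos x" unfolding a_def using lcos_right[OF c(1) inverse_N[OF p]] .
    have b: "a * s \<in> lcos y" using mult_quotient[OF s(1) a] .
    have cb: "c + a * s \<in> lcos x" using lcos_right[OF a ps] ap by (simp add: distrib_left)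
    have "1 + c + a * s \<in> N" using absorb(1)[OF c(1) b cb one_N c(2)] .
    \<comment> \<open>\<open>a * s\<close> is exchanged for \<open>- a\<close> at the cost of a
      factor \<open>k\<close>; the factors \<open>k\<close> and \<open>q\<close> are later cancelled
      by \<open>n\<close>.\<close>
    then have "(1 + c) * k + a * (- 1) \<in> N"
      using quotient_larger[OF s(1) _ k(1) minus_one_N a c(2)] k(2) by simp
    then have "(1 + c) * k * q + a * (- 1) \<in> N"
      using cone_scale_left[OF x0 q mult_N[OF c(2) k(1)] lcos_right[OF a minus_one_N]] by blast
    from mult_N[OF this n] have "(1 + c) * ((k * q) * n) - a * n \<in> N"
      by (simp add: left_diff_distrib mult.assoc)
    moreover have "(k * q) * n = 1" unfolding n_def using k0 q0 by simp
    ultimately have "1 + c - a * n \<in> N" by simp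
    moreover have "1 + c - a * n = 1 + a" unfolding ap[symmetric] p_def by (simp add: algebra_simps)
    ultimately have "1 + a \<in> N" by simp
    from mult_N[OF this p] show ?thesis unfolding ap[symmetric] by (simp add: distrib_right)
  qed
  then show ?thesis using p unfolding cone_def p_def n_def by blast
qed

text \<open>One \<open>k\<close> serves all later purposes: its inverse is strictly positive, the
  elements \<open>inverse (k * q)\<close> lie above the level, and multiplication by
  \<open>k\<close> moves the cone of \<open>y\<close>, with both signs, into that of
  \<open>x\<close>.\<close>

lemma small_element:
  obtains k where "k \<in> cone (lcos x)" "inverse k \<notin> cone (lcos x)"
    "\<forall>q\<in>cone (lcos x). 1 + inverse (k * q) \<in> cone (lcos x) \<and> 1 - inverse (k * q) \<in> cone (lcos x)"
    "\<forall>q\<in>cone (lcos y). q * k \<in> cone (lcos x) \<and> - (q * k) \<in> cone (lcos x)"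
proof -
  obtain l where l: "l \<in> N" "1 + inverse x * y * l \<in> N" using coset_witness_one_plus .
  define s where "s = inverse x * y * l"
  have s: "x * s \<in> lcos y" "1 + s \<in> N"
    using l x0 lcos_right[OF lcos_self l(1)] unfolding s_def by (auto simp: mult.assoc[symmetric])
  obtain a1 where a1: "a1 \<in> lcos x" "1 - a1 \<in> lcos x" using coset_witness_one_minus[OF outside_x] .
  obtain b1 where b1: "b1 \<in> lcos y" "1 - b1 \<in> lcos y" using coset_witness_one_minus[OF outside_y] .
  obtain a2 where a2: "a2 \<in> lcos x" "a2 + b1 \<in> lcos x" using coset_witness_add[OF x0] .
  obtain h where h: "h \<in> N" "1 + x * h \<in> N" using coset_witness_one_plus .
  define a3 where "a3 = x * h"
  have a3: "a3 \<in> lcos x" "1 + a3 \<in> N" "a3 \<noteq> 0"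
    using h x0 nonzero_N unfolding a3_def lcos_def by auto
  \<comment> \<open>The shifts by \<open>\<plusminus> inverse s\<close> are for
    \<open>quotient_larger\<close>, those by \<open>\<plusminus> a1\<close> and
    \<open>\<plusminus> a2\<close> for \<open>one_plus_inverse_N\<close> with \<open>k\<close> and
    \<open>- k\<close>, and \<open>inverse a3\<close> keeps \<open>inverse k\<close> out of the
    cone.\<close>
  obtain k where k: "k \<in> N"
    "\<And>f. f \<in> {inverse s, - inverse s, a1, - a1, a2, - a2, inverse a3} \<Longrightarrow> k + f \<in> N"
    using N_thick[of "{inverse s, - inverse s, a1, - a1, a2, - a2, inverse a3}"] by blast
  have k0: "k \<noteq> 0" using k(1) zero_N by blast
  have pm: "1 + inverse (k' * q) \<in> cone (lcos x)"
    if k': "k' \<in> N" "k' - inverse s \<in> N" "k' + a1 \<in> N" "k' + a2 \<in> N" and q: "q \<in> cone (lcos x)" for k' q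
  proof -
    have "1 + inverse (k' * q) \<in> N" if q: "q \<in> cone (lcos x)" for q
    proof -
      have m: "k' * q \<in> N" using mult_N k'(1) q cone_subset by blast
      have "k' * q + a1 \<in> N" using cone_scale_left[OF x0 q k'(1) a1(1) k'(3)] .
      \<comment> \<open>The cone of \<open>x\<close> only controls sums with the coset of
        \<open>x\<close>; \<open>a2\<close> transfers this to \<open>b1\<close>.\<close>
      moreover have "k' * q + a2 \<in> N" using cone_scale_left[OF x0 q k'(1) a2(1) k'(4)] .
      then have "k' * q + b1 \<in> N" using absorb(2)[OF a2(1) b1(1) a2(2) m] by blast
      ultimately show ?thesis using one_plus_inverse_N[OF m a1(2) _ b1(2)] by blast
    qed
    then show ?thesis using one_plus_small_cone[OF s _ k'(1,2) q] by blast
  qed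
  have neg: "- k - inverse s \<in> N" "- k + a1 \<in> N" "- k + a2 \<in> N"
    using k(2)[of "inverse s"] k(2)[of "- a1"] k(2)[of "- a2"]
      minus_N[of "k + inverse s"] minus_N[of "k - a1"] minus_N[of "k - a2"] by auto
  have A: "1 + inverse (k * q) \<in> cone (lcos x) \<and> 1 - inverse (k * q) \<in> cone (lcos x)"
    if q: "q \<in> cone (lcos x)" for q
    using pm[OF k(1) _ _ _ q] pm[OF minus_N[OF k(1)] neg q] k(2)[of "- inverse s"] k(2)[of a1] k(2)[of a2]
    by (simp add: nonzero_inverse_minus_eq)
  have B: "q * k \<in> cone (lcos x) \<and> - (q * k) \<in> cone (lcos x)" if q: "q \<in> cone (lcos y)" for q
  proof -
    have qN: "q \<in> N" using q cone_subset by blast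
    have "q * k + c \<in> N \<and> - (q * k) + c \<in> N" if c: "c \<in> lcos x" "1 + c \<in> N" for c
    proof -
      \<comment> \<open>A detour through the coset of \<open>y\<close>, where \<open>q\<close> is
        effective; \<open>c\<close> is recovered with either sign at the cost of
        \<open>k\<close>.\<close>
      have "1 + c * s \<in> N" using quotient_smaller[OF s c(1) one_N c(2)] .
      then have qc: "q + c * s \<in> N" using q mult_quotient[OF s(1) c(1)] unfolding cone_def by blast
      have 1: "q * k + c * 1 \<in> N"
        using quotient_larger[OF s(1) _ k(1) one_N c(1) qN qc] k(2)[of "inverse s"] by simp
      have "q * k + c * (- 1) \<in> N"
        using quotient_larger[OF s(1) _ k(1) minus_one_N c(1) qN qc] k(2)[of "- inverse s"] by simp
      then show ?thesis using 1 minus_N[of "q * k + c * (- 1)"] by simp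
    qed
    then show ?thesis unfolding cone_def using mult_N[OF qN k(1)] minus_N by blast
  qed
  have "inverse k \<notin> cone (lcos x)"
  proof
    assume "inverse k \<in> cone (lcos x)"
    then have 1: "inverse k + a3 \<in> N" using a3 unfolding cone_def by blast
    \<comment> \<open>The choice of \<open>k\<close> puts \<open>inverse k + a3\<close> into the
      coset of \<open>x\<close>, hence not into \<open>N\<close>.\<close>
    have "a3 * (k + inverse a3) * inverse k \<in> lcos x"
      using lcos_right[OF lcos_right[OF a3(1) k(2)] inverse_N[OF k(1)]] by blast
    also have "a3 * (k + inverse a3) * inverse k = inverse k + a3"
      using a3(3) k0 by (simp add: distrib_left distrib_right mult.assoc add.commute)
    finally show False using lcos_outside[OF outside_x] 1 unfolding outside_def by blast
  qed
  moreover have "k \<in> cone (lcos x)" using B[OF cone_one] by simp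
  ultimately show thesis using that A B by blast
qed

text \<open>This bounds a finite subset of \<open>N\<close> from below, which will make a spanning
  list nonnegative. \<open>1 + c * s\<close> leads to \<open>k + c * n\<close>, and by thickness one
  \<open>k\<close> serves all \<open>n\<close>.\<close>

lemma cone_cofinal:
  assumes "finite F" "F \<subseteq> N"
  obtains k where "k \<in> N" "\<And>n. n \<in> F \<Longrightarrow> k * inverse n \<in> cone (lcos x)"
proof -
  obtain l where l: "l \<in> N" "1 + inverse x * y * l \<in> N" using coset_witness_one_plus .
  define s where "s = inverse x * y * l"
  have s: "x * s \<in> lcos y" "1 + s \<in> N"
    using l x0 lcos_right[OF lcos_self l(1)] unfolding s_def by (auto simp: mult.assoc[symmetric])
  obtain k where k: "k \<in> N" "\<And>f. f \<in> (\<lambda>n. inverse s * n) ` F \<Longrightarrow> k + f \<in> N"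
    using N_thick[of "(\<lambda>n. inverse s * n) ` F"] assms(1) by blast
  have "k * inverse n \<in> cone (lcos x)" if "n \<in> F" for n
  proof -
    have n: "n \<in> N" "n \<noteq> 0" using that assms(2) zero_N by auto
    have "k * inverse n + c \<in> N" if c: "c \<in> lcos x" "1 + c \<in> N" for c
    proof -
      have "1 + c * s \<in> N" using quotient_smaller[OF s c(1) one_N c(2)] .
      then have "k + c * n \<in> N"
        using quotient_larger[OF s(1) k(2)[OF imageI[OF \<open>n \<in> F\<close>]] k(1) n(1) c(1) one_N] by simp
      from mult_N[OF this inverse_N[OF n(1)]] show ?thesis
        using n(2) by (simp add: distrib_right mult.assoc)
    qed
    then show ?thesis unfolding cone_def using mult_N[OF k(1) inverse_N[OF n(1)]] by blast
  qed
  then show thesis using that k(1) by blast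
qed

end

section \<open>Cosets at distance at least four and five\<close>

locale far4_pair = far_pair +
  assumes far4: "outside c \<Longrightarrow> outside d \<Longrightarrow> A x c \<Longrightarrow> A c d \<Longrightarrow> A d y \<Longrightarrow> False"
begin

lemma far4': "a \<in> lcos x \<Longrightarrow> b \<in> lcos y \<Longrightarrow> outside c \<Longrightarrow> outside d \<Longrightarrow> A c a \<Longrightarrow> A c d \<Longrightarrow> A d b \<Longrightarrow> False"
  using far4[of c d] A_lcos[of a c x x] A_lcos[of b d y y] A_sym lcos_self x0 y0 by blast

text \<open>Let \<open>a\<close> witness that \<open>t\<close> is not in the cone of
  \<open>x\<close>, and suppose that \<open>b\<close> does so for \<open>1 - t\<close> and
  \<open>y\<close>. Then \<open>t + a\<close> and \<open>1 - t + b\<close> have the sum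
  \<open>1 + a + b\<close>, in \<open>N\<close> by \<open>sum_N\<close>, and they link
  \<open>a\<close> to \<open>b\<close> in three steps.\<close>

lemma one_minus_cone:
  assumes t: "t \<in> N" "t \<notin> cone (lcos x)" "1 - t \<in> N"
  shows "1 - t \<in> cone (lcos y)"
proof -
  obtain a where a: "a \<in> lcos x" "1 + a \<in> N" "t + a \<notin> N" using t unfolding cone_def by blast
  have oa: "outside a" using lcos_outside[OF outside_x a(1)] .
  have oe: "outside (t + a)" using outside_add'[OF oa t(1) a(3)] .
  have "1 - t + b \<in> N" if b: "b \<in> lcos y" "1 + b \<in> N" for b
  proof (rule ccontr)
    assume n: "1 - t + b \<notin> N"
    have ob: "outside b" using lcos_outside[OF outside_y b(1)] .
    have od: "outside (1 - t + b)" using outside_add'[OF ob t(3) n] .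
    have "(t + a) + (1 - t + b) = 1 + a + b" by (simp add: algebra_simps)
    then have "(t + a) + (1 - t + b) \<in> N" using sum_N[OF a(1) b(1) a(2) b(2)] by (simp only:)
    then have "A (t + a) (1 - t + b)" using A_sum[OF oe od] by blast
    then show False using far4'[OF a(1) b(1) oe od A_add'[OF oa t(1) a(3)] _ A_add'[OF ob t(3) n]] by blast
  qed
  then show ?thesis unfolding cone_def using t(3) by blast
qed

text \<open>The sum of \<open>t - a * b\<close> with \<open>a * t\<close> and its difference with
  \<open>b\<close> are shown to lie in \<open>N\<close>; outside \<open>N\<close> it would be near
  both.\<close>

lemma diff_prod_N:
  assumes a: "a \<in> lcos x" and b: "b \<in> lcos y" and t: "t \<in> N" and v: "1 + a \<in> N" and w: "t - b \<in> N"
  shows "t - a * b \<in> N"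
proof (rule ccontr)
  assume z: "t - a * b \<notin> N"
  interpret sw: far_pair N A y x by (rule swap)
  have t0: "t \<noteq> 0" and w0: "t - b \<noteq> 0" using t w nonzero_N by blast+
  have oa: "outside a" and ob: "outside b" using lcos_outside[OF outside_x a] lcos_outside[OF outside_y b] by auto
  \<comment> \<open>\<open>(inverse u + a) * (u * t)\<close> expands to
    \<open>(t - a * b) + a * t\<close>.\<close>
  define u where "u = 1 - b * inverse t"
  have uw: "u * t = t - b" unfolding u_def using t0 by (simp add: left_diff_distrib mult.assoc)
  have u: "u \<in> N" using w mult_right_N_iff[OF t, of u] uw by simp
  have u0: "u \<noteq> 0" using u zero_N by blast
  have "1 + u * a \<in> N"
  proof -
    have "- (b * inverse t) \<in> lcos y" using lcos_minus[OF lcos_right[OF b inverse_N[OF t]]] .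
    moreover have "u * a \<in> lcos x" using lcos_left[OF x0 a u] .
    moreover have "1 + u * a + - (b * inverse t) \<in> N"
      using mult_N[OF u v] unfolding u_def by (simp add: algebra_simps)
    ultimately show ?thesis using sum_ND one_N by blast
  qed
  from mult_N[OF inverse_N[OF u] this] have "inverse u + a \<in> N"
    using u0 by (simp add: distrib_left mult.assoc[symmetric])
  then have "(inverse u + a) * (u * t) \<in> N" using mult_N[OF _ mult_N[OF u t]] by blast
  moreover have "(inverse u + a) * (u * t) = t + a * (t - b)"
    using u0 unfolding uw[symmetric] by (simp add: distrib_right mult.assoc[symmetric])
  moreover have "t + a * (t - b) = (t - a * b) + a * t" by (simp add: right_diff_distrib)
  ultimately have 1: "(t - a * b) + a * t \<in> N" by (simp only:)
  have v0: "1 + a \<noteq> 0" using v nonzero_N by blast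
  have 2: "(t - a * b) - b \<in> N"
  proof -
    \<comment> \<open>\<open>(1 + c) * t\<close> is \<open>t - a * b - b\<close>, and
      \<open>1 + c + a\<close> is \<open>(1 + a) * u\<close>.\<close>
    define c where "c = - ((1 + a) * (b * inverse t))"
    have c: "c \<in> lcos y" unfolding c_def using lcos_minus[OF lcos_left[OF y0 lcos_right[OF b inverse_N[OF t]] v]] .
    have "(1 + a) * u \<in> N" using mult_N[OF v u] .
    then have "1 + c + a \<in> N" unfolding c_def u_def by (simp add: algebra_simps)
    then have "1 + c \<in> N" using sw.sum_ND[OF c a one_N] by blast
    then have "(1 + c) * t \<in> N" using mult_N t by blast
    then show ?thesis unfolding c_def using t0 by (simp add: algebra_simps)
  qed
  have at: "a * t \<in> lcos x" using lcos_right[OF a t] .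
  have "t - a * b \<noteq> 0" using 1 lcos_outside[OF outside_x at] unfolding outside_def by auto
  then have oz: "outside (t - a * b)" using z unfolding outside_def by blast
  have "A (t - a * b) (a * t)" using A_sum[OF oz lcos_outside[OF outside_x at] 1] .
  moreover have "A (t - a * b) b" using V1[OF oz ob 2] .
  ultimately show False using far3'[OF at b oz] by blast
qed

text \<open>This is where distance four enters: \<open>t + a\<close> is adjacent to \<open>a\<close> and to \<open>a * (1 + b)\<close>, hence to
  \<open>1 + b\<close> by (V3), which gives a walk of length three from \<open>a\<close> to \<open>b\<close>.\<close>

lemma comparable:
  assumes a: "a \<in> lcos x" and b: "b \<in> lcos y" and t: "t \<in> N" and v: "1 + a \<in> N" and w: "t - b \<in> N"
    and g: "1 + b \<notin> N"
  shows "t + a \<in> N"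
proof (rule ccontr)
  assume e: "t + a \<notin> N"
  have oa: "outside a" and ob: "outside b" using lcos_outside[OF outside_x a] lcos_outside[OF outside_y b] by auto
  have oe: "outside (t + a)" using outside_add'[OF oa t e] .
  have og: "outside (1 + b)" using outside_add'[OF ob one_N g] .
  have ea: "A (t + a) a" using A_add'[OF oa t e] .
  have gb: "A (1 + b) b" using A_add'[OF ob one_N g] .
  have dif: "a * (1 + b) - (t + a) \<in> N"
    using minus_N[OF diff_prod_N[OF a b t v w]] by (simp add: algebra_simps)
  show False
  proof (cases "a * (1 + b) \<in> N")
    \<comment> \<open>Now \<open>1 + b\<close> lies in the coset of \<open>inverse a\<close>, which
      (V2) puts near \<open>a\<close>.\<close>
    case True
    have a0: "a \<noteq> 0" using oa unfolding outside_def by simp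
    have "A (inverse a) a" using V2[OF oa oa A_refl[OF oa]] .
    from A_coset[OF this True] have "A (1 + b) a" using a0 by (simp add: mult.assoc[symmetric])
    then show False using far3'[OF a b og _ gb] by blast
  next
    case False
    then have oag: "outside (a * (1 + b))" using oa og unfolding outside_def by auto
    have "A (a * (1 + b)) (t + a)" using V1[OF oag oe dif] .
    from V3[OF oa og oe False A_sym[OF ea] this] have "A (t + a) (1 + b)" using A_sym by blast
    then show False using far4'[OF a b oe og ea _ gb] by blast
  qed
qed

text \<open>Dividing a witness \<open>b\<close> against \<open>t\<close> by \<open>t\<close> gives
  \<open>c\<close> with \<open>1 + c \<notin> N\<close> and \<open>- inverse t - c \<in> N\<close>,
  as \<open>comparable\<close> requires for \<open>- inverse t\<close>.\<close>

lemma cone_total: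
  assumes t: "t \<in> N" "t \<notin> cone (lcos y)"
  shows "- inverse t \<in> cone (lcos x)"
proof -
  obtain b where b: "b \<in> lcos y" "1 + b \<in> N" "t + b \<notin> N" using t unfolding cone_def by blast
  have t0: "t \<noteq> 0" using t(1) zero_N by blast
  define c where "c = inverse t * b"
  have c: "c \<in> lcos y" unfolding c_def using lcos_left[OF y0 b(1) inverse_N[OF t(1)]] .
  have tc: "t * c = b" unfolding c_def using t0 by (simp add: mult.assoc[symmetric])
  have g: "1 + c \<notin> N" using mult_N[OF t(1), of "1 + c"] b(3) tc by (auto simp: distrib_left)
  have "inverse t * (1 + b) \<in> N" using mult_N[OF inverse_N[OF t(1)] b(2)] .
  then have "- inverse t - c \<in> N" using minus_N[of "inverse t * (1 + b)"] unfolding c_def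
    by (simp add: distrib_left)
  then have "- inverse t + a \<in> N" if "a \<in> lcos x" "1 + a \<in> N" for a
    using comparable[OF that(1) c minus_N[OF inverse_N[OF t(1)]] that(2) _ g] by blast
  then show ?thesis unfolding cone_def using minus_N[OF inverse_N[OF t(1)]] by blast
qed

end

locale far5_pair = far4_pair +
  assumes far5: "outside c \<Longrightarrow> outside d \<Longrightarrow> outside e \<Longrightarrow> A x c \<Longrightarrow> A c d \<Longrightarrow> A d e \<Longrightarrow> A e y \<Longrightarrow> False"
begin

text \<open>With witnesses \<open>a\<close> and \<open>b\<close> against the two cones,
  \<open>1 - t\<close> has sum \<open>1 + a\<close> with \<open>t + a\<close> and
  \<open>1 + b\<close> with \<open>t + b\<close>. Outside \<open>N\<close> it would be the middle of
  a walk \<open>x\<close>, \<open>t + a\<close>, \<open>1 - t\<close>, \<open>t + b\<close>,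
  \<open>y\<close>.\<close>

lemma one_minus_N:
  assumes t: "t \<in> N" "t \<notin> cone (lcos x)" "t \<notin> cone (lcos y)"
  shows "1 - t \<in> N"
proof (rule ccontr)
  assume n: "1 - t \<notin> N"
  obtain a where a: "a \<in> lcos x" "1 + a \<in> N" "t + a \<notin> N" using t unfolding cone_def by blast
  obtain b where b: "b \<in> lcos y" "1 + b \<in> N" "t + b \<notin> N" using t unfolding cone_def by blast
  have oa: "outside a" and ob: "outside b" using lcos_outside[OF outside_x a(1)] lcos_outside[OF outside_y b(1)] by auto
  have oe: "outside (t + a)" and og: "outside (t + b)"
    using outside_add'[OF oa t(1) a(3)] outside_add'[OF ob t(1) b(3)] .
  have "t \<noteq> 1" using t(2) cone_one by blast
  then have of: "outside (1 - t)" using n unfolding outside_def by auto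
  have "A (1 - t) (t + a)" using A_sum[OF of oe] a(2) by simp
  moreover have "A (1 - t) (t + b)" using A_sum[OF of og] b(2) by simp
  moreover have "A x (t + a)" using A_lcos[OF A_sym[OF A_add'[OF oa t(1) a(3)]] lcos_self a(1) x0] .
  moreover have "A y (t + b)" using A_lcos[OF A_sym[OF A_add'[OF ob t(1) b(3)]] lcos_self b(1) y0] .
  ultimately show False using far5[OF oe of og] A_sym by blast
qed

end

section \<open>Bases inside spanning sets\<close>

context ring
begin

lemma Span_mem_Cons: "w \<in> Span k (u # us) \<longleftrightarrow> (\<exists>c\<in>k. \<exists>v\<in>Span k us. w = c \<otimes> u \<oplus> v)"
  by (simp add: line_extension_mem_iff)

lemma filter_base_subset:
  assumes "subfield k R" "set us \<subseteq> carrier R"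
  shows "\<exists>vs. set vs \<subseteq> set us \<and> independent k vs \<and> Span k vs = Span k us"
  using assms(2)
proof (induction us)
  case (Cons u us)
  then obtain vs where vs: "set vs \<subseteq> set us" "independent k vs" "Span k vs = Span k us" by auto
  show ?case
  proof (cases "u \<in> Span k us")
    case True
    have "set (u # us) \<subseteq> Span k us" using True Span_base_incl[OF assms(1)] Cons.prems by simp
    then have "Span k (u # us) = Span k us"
      using mono_Span_subset[OF assms(1), of "u # us" us] mono_Span[OF assms(1), of us u] Cons.prems
      by (simp del: Span.simps add: subset_antisym)
    then show ?thesis using vs by (metis set_subset_Cons subset_trans)
  next
    case False
    then have "independent k (u # vs)" "Span k (u # vs) = Span k (u # us)"
      using vs Cons.prems by (auto intro: li_Cons)
    then show ?thesis using vs(1) by (metis insert_mono list.simps(15))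
  qed
qed auto

end

lemma ring_of_type_algebra_simps [simp]:
  "carrier (ring_of_type_algebra :: 'a::division_ring ring) = UNIV"
  "x \<otimes>\<^bsub>ring_of_type_algebra\<^esub> y = x * y" "x \<oplus>\<^bsub>ring_of_type_algebra\<^esub> y = x + y"
  "\<zero>\<^bsub>ring_of_type_algebra\<^esub> = 0"
  for x y :: "'a::division_ring"
  by (simp_all add: ring_of_type_algebra_def)

text \<open>Scalars act from the left, so right multiplication by \<open>t\<close> is linear over
  \<open>k\<close>.\<close>

lemma Span_mult_right:
  fixes w :: "'a::division_ring"
  assumes "w \<in> ring.Span ring_of_type_algebra k us"
  shows "w * t \<in> ring.Span ring_of_type_algebra k (map (\<lambda>u. u * t) us)"
proof -
  interpret R: ring "ring_of_type_algebra :: 'a ring" by (rule ring_ring_of_type_algebra)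
  show ?thesis using assms
  proof (induction us arbitrary: w)
    case Nil
    then show ?case by (simp add: R.Span.simps)
  next
    case (Cons u us)
    then obtain c v where "c \<in> k" "v \<in> R.Span k us" "w = c * u + v"
      unfolding R.Span_mem_Cons by auto
    then show ?case unfolding list.map R.Span_mem_Cons
      using Cons.IH by (intro bexI[of _ c] bexI[of _ "v * t"]) (auto simp: distrib_right mult.assoc)
  qed
qed

lemma contains_basis_overI:
  fixes us :: "'a::division_ring list"
  assumes "subfield k (ring_of_type_algebra :: 'a ring)" "set us \<subseteq> S"
    "ring.Span ring_of_type_algebra k us = UNIV"
  shows "contains_basis_over S k"
proof -
  interpret R: ring "ring_of_type_algebra :: 'a ring" by (rule ring_ring_of_type_algebra)
  obtain vs where "set vs \<subseteq> set us" "R.independent k vs" "R.Span k vs = R.Span k us"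
    using R.filter_base_subset[OF assms(1), of us] by auto
  then show ?thesis using assms(2,3) unfolding contains_basis_over_def
    by (intro exI[of _ vs] conjI) (simp_all del: R.Span.simps)
qed

text \<open>Thickness moves a basis into \<open>N\<close>: some \<open>m\<close> and all
  \<open>m + d\<close> lie in \<open>N\<close>, and each \<open>d\<close> is a difference of
  these.\<close>

lemma (in finite_index_normal) spanning_list_N:
  assumes k: "subfield k (ring_of_type_algebra :: 'a ring)"
    and fd: "ring.finite_dimension (ring_of_type_algebra :: 'a ring) k UNIV"
  obtains us where "set us \<subseteq> N" "ring.Span ring_of_type_algebra k us = UNIV"
proof -
  interpret R: ring "ring_of_type_algebra :: 'a ring" by (rule ring_ring_of_type_algebra)
  obtain n where "R.dimension n k UNIV" using fd unfolding R.finite_dimension_def by blast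
  then obtain bs where bs: "R.Span k bs = UNIV" using R.exists_base[OF k] by blast
  obtain m where m: "m \<in> N" "\<And>d. d \<in> set bs \<Longrightarrow> m + d \<in> N" using N_thick[of "set bs"] by blast
  define us where "us = m # map ((+) m) bs"
  have us: "set us \<subseteq> R.Span k us" using R.Span_base_incl[OF k, of us] by (simp del: R.Span.simps)
  have "d \<in> R.Span k us" if "d \<in> set bs" for d
  proof -
    have 1: "m + d \<in> R.Span k us" "m \<in> R.Span k us"
      using us that unfolding us_def by (auto simp del: R.Span.simps)
    have "\<ominus>\<^bsub>ring_of_type_algebra\<^esub> m \<oplus>\<^bsub>ring_of_type_algebra\<^esub> (m + d) \<in> R.Span k us"
      using R.Span_subgroup_props(3,4)[OF k, of us] 1 by (simp del: R.Span.simps)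
    moreover have "\<ominus>\<^bsub>ring_of_type_algebra\<^esub> m \<oplus>\<^bsub>ring_of_type_algebra\<^esub> (m + d) = d"
      using R.minus_equality[of "- m" m] by simp
    ultimately show ?thesis by (simp only:)
  qed
  then have "R.Span k bs \<subseteq> R.Span k us" using R.mono_Span_subset[OF k, of bs us]
    by (auto simp del: R.Span.simps)
  then have "R.Span k us = UNIV" using bs by blast
  moreover have "set us \<subseteq> N" unfolding us_def using m by auto
  ultimately show thesis using that by blast
qed

section \<open>The ordered group defined by a normal cone\<close>

locale normal_cone = finite_index_normal N for N :: "'a::division_ring set" +
  fixes M :: "'a set"
  assumes M_N: "M \<subseteq> N"
    and M_one: "1 \<in> M"
    and M_mult: "s \<in> M \<Longrightarrow> t \<in> M \<Longrightarrow> s * t \<in> M"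
    and M_conj: "u \<in> N \<Longrightarrow> t \<in> M \<Longrightarrow> u * t * inverse u \<in> M"
begin

definition U :: "'a set" where
  "U = {t \<in> M. inverse t \<in> M}"

text \<open>Cosets of \<open>U\<close> are the elements of the quotient group, so \<open>cl\<close>
  is also the map to be constructed.\<close>

definition cl :: "'a \<Rightarrow> 'a set" where
  "cl n = (*) n ` U"

text \<open>\<open>M\<close> is the cone of the elements that are at most \<open>0\<close>.\<close>

definition \<Gamma> :: "'a set ordered_monoid" where
  "\<Gamma> = \<lparr>carrier = cl ` N, monoid.mult = (\<lambda>S T. {s * t | s t. s \<in> S \<and> t \<in> T}), one = U,
        ord_rel = {(cl m, cl n) | m n. m \<in> N \<and> n \<in> N \<and> inverse n * m \<in> M}\<rparr>"

lemma M_conj': "u \<in> N \<Longrightarrow> t \<in> M \<Longrightarrow> inverse u * t * u \<in> M"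
  using M_conj[of "inverse u" t] inverse_N by (simp add: nonzero_N)

lemma U_N: "t \<in> U \<Longrightarrow> t \<in> N" and U_M: "t \<in> U \<Longrightarrow> t \<in> M"
  and U_one: "1 \<in> U" and U_inverse: "t \<in> U \<Longrightarrow> inverse t \<in> U"
  unfolding U_def using M_N M_one nonzero_N by auto

lemma U_mult: "s \<in> U \<Longrightarrow> t \<in> U \<Longrightarrow> s * t \<in> U"
proof -
  assume st: "s \<in> U" "t \<in> U"
  then have "inverse (s * t) = inverse t * inverse s"
    using U_N nonzero_N by (simp add: nonzero_inverse_mult_distrib)
  with st show "s * t \<in> U" unfolding U_def using M_mult by auto
qed

lemma U_conj': "u \<in> N \<Longrightarrow> t \<in> U \<Longrightarrow> inverse u * t * u \<in> U"
proof -
  assume *: "u \<in> N" "t \<in> U"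
  then have nz: "u \<noteq> 0" "t \<noteq> 0" using U_N nonzero_N by auto
  have "inverse (inverse u * t * u) = inverse u * inverse t * u"
    using nz by (simp add: nonzero_inverse_mult_distrib mult.assoc)
  then show ?thesis using * M_conj' unfolding U_def by auto
qed

lemma mem_cl: "n \<in> N \<Longrightarrow> g \<in> cl n \<longleftrightarrow> inverse n * g \<in> U"
proof
  assume n: "n \<in> N" and "inverse n * g \<in> U"
  then have "n * (inverse n * g) \<in> cl n" unfolding cl_def by blast
  then show "g \<in> cl n" using nonzero_N[OF n] by (simp add: mult.assoc[symmetric])
qed (auto simp: cl_def mult.assoc[symmetric] nonzero_N)

lemma cl_eq_iff: "m \<in> N \<Longrightarrow> n \<in> N \<Longrightarrow> cl m = cl n \<longleftrightarrow> inverse m * n \<in> U"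
proof
  assume mn: "m \<in> N" "n \<in> N"
  then have nz: "m \<noteq> 0" "n \<noteq> 0" using nonzero_N by auto
  {
    assume "cl m = cl n"
    moreover have "n \<in> cl n" using mem_cl[OF mn(2)] U_one nz by simp
    ultimately show "inverse m * n \<in> U" using mem_cl[OF mn(1)] by blast
  next
    assume *: "inverse m * n \<in> U"
    have "inverse (inverse m * n) = inverse n * m" using nz by (simp add: nonzero_inverse_mult_distrib)
    then have **: "inverse n * m \<in> U" using U_inverse[OF *] by simp
    have "inverse m * g \<in> U \<longleftrightarrow> inverse n * g \<in> U" for g
    proof -
      have "inverse n * g = (inverse n * m) * (inverse m * g)" "inverse m * g = (inverse m * n) * (inverse n * g)"
        using nz by (simp_all add: mult.assoc) (simp_all add: mult.assoc[symmetric])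
      then show ?thesis using U_mult[OF *] U_mult[OF **] by metis
    qed
    then show "cl m = cl n" using mem_cl mn by blast
  }
qed

text \<open>The order does not depend on representatives: changing them multiplies by elements of
  \<open>U\<close>, hence of \<open>M\<close>.\<close>

lemma ord_iff: "m \<in> N \<Longrightarrow> n \<in> N \<Longrightarrow> (cl m, cl n) \<in> ord_rel \<Gamma> \<longleftrightarrow> inverse n * m \<in> M"
proof
  assume mn: "m \<in> N" "n \<in> N"
  assume "(cl m, cl n) \<in> ord_rel \<Gamma>"
  then obtain m' n' where *: "cl m = cl m'" "cl n = cl n'" "m' \<in> N" "n' \<in> N" "inverse n' * m' \<in> M"
    unfolding \<Gamma>_def by auto
  have nz: "m \<noteq> 0" "n \<noteq> 0" "m' \<noteq> 0" "n' \<noteq> 0" using nonzero_N mn * by auto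
  have "inverse n * n' \<in> M" "inverse m' * m \<in> M"
    using cl_eq_iff mn * U_M by metis+
  then have "(inverse n * n') * (inverse n' * m') * (inverse m' * m) \<in> M" using * M_mult by blast
  moreover have "(inverse n * n') * (inverse n' * m') * (inverse m' * m) = inverse n * (n' * inverse n') * (m' * inverse m') * m"
    by (simp only: mult.assoc)
  ultimately show "inverse n * m \<in> M" using nz by simp
qed (auto simp: \<Gamma>_def)

lemma cl_mult: "m \<in> N \<Longrightarrow> n \<in> N \<Longrightarrow> cl m \<otimes>\<^bsub>\<Gamma>\<^esub> cl n = cl (m * n)"
proof -
  assume mn: "m \<in> N" "n \<in> N"
  then have nz: "m \<noteq> 0" "n \<noteq> 0" using nonzero_N by auto
  have "{s * t | s t. s \<in> cl m \<and> t \<in> cl n} = cl (m * n)"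
  proof (intro equalityI subsetI)
    fix g assume "g \<in> {s * t | s t. s \<in> cl m \<and> t \<in> cl n}"
    then obtain u v where uv: "u \<in> U" "v \<in> U" "g = m * u * (n * v)" unfolding cl_def by blast
    have "g = m * (n * inverse n) * u * (n * v)" using uv(3) nz by simp
    then have "g = (m * n) * ((inverse n * u * n) * v)" by (simp only: mult.assoc)
    then show "g \<in> cl (m * n)" unfolding cl_def using U_mult[OF U_conj'[OF mn(2) uv(1)] uv(2)] by blast
  next
    fix g assume "g \<in> cl (m * n)"
    then obtain u where "u \<in> U" "g = m * n * u" unfolding cl_def by blast
    then have "g = (m * 1) * (n * u)" "m * 1 \<in> cl m" "n * u \<in> cl n"
      unfolding cl_def using U_one by (auto simp: mult.assoc)
    then show "g \<in> {s * t | s t. s \<in> cl m \<and> t \<in> cl n}" by blast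
  qed
  then show ?thesis by (simp add: \<Gamma>_def)
qed

lemma carrier_\<Gamma>: "carrier \<Gamma> = cl ` N"
  by (simp add: \<Gamma>_def)

lemma one_\<Gamma>: "\<one>\<^bsub>\<Gamma>\<^esub> = cl 1"
  by (simp add: \<Gamma>_def cl_def)

lemma ord_carrier: "(S, T) \<in> ord_rel \<Gamma> \<Longrightarrow> S \<in> cl ` N \<and> T \<in> cl ` N"
  by (auto simp: \<Gamma>_def)

lemma group_\<Gamma>: "group \<Gamma>"
proof (rule groupI)
  show "\<one>\<^bsub>\<Gamma>\<^esub> \<in> carrier \<Gamma>" unfolding one_\<Gamma> carrier_\<Gamma> using one_N by blast
next
  fix S T assume "S \<in> carrier \<Gamma>" "T \<in> carrier \<Gamma>"
  then show "S \<otimes>\<^bsub>\<Gamma>\<^esub> T \<in> carrier \<Gamma>" unfolding carrier_\<Gamma> using cl_mult mult_N by auto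
next
  fix S T V assume "S \<in> carrier \<Gamma>" "T \<in> carrier \<Gamma>" "V \<in> carrier \<Gamma>"
  then show "S \<otimes>\<^bsub>\<Gamma>\<^esub> T \<otimes>\<^bsub>\<Gamma>\<^esub> V = S \<otimes>\<^bsub>\<Gamma>\<^esub> (T \<otimes>\<^bsub>\<Gamma>\<^esub> V)"
    unfolding carrier_\<Gamma> by (auto simp: cl_mult mult_N mult.assoc)
next
  fix S assume "S \<in> carrier \<Gamma>"
  then show "\<one>\<^bsub>\<Gamma>\<^esub> \<otimes>\<^bsub>\<Gamma>\<^esub> S = S" unfolding carrier_\<Gamma> one_\<Gamma> using cl_mult[OF one_N] by auto
next
  fix S assume "S \<in> carrier \<Gamma>"
  then obtain n where n: "n \<in> N" "S = cl n" unfolding carrier_\<Gamma> by blast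
  then have "cl (inverse n) \<otimes>\<^bsub>\<Gamma>\<^esub> S = \<one>\<^bsub>\<Gamma>\<^esub>"
    using cl_mult[OF inverse_N] nonzero_N by (simp add: one_\<Gamma>)
  then show "\<exists>T\<in>carrier \<Gamma>. T \<otimes>\<^bsub>\<Gamma>\<^esub> S = \<one>\<^bsub>\<Gamma>\<^esub>" unfolding carrier_\<Gamma> using inverse_N[OF n(1)] by blast
qed

lemma partial_order_\<Gamma>: "partial_order_on (carrier \<Gamma>) (ord_rel \<Gamma>)"
proof -
  have "refl_on (carrier \<Gamma>) (ord_rel \<Gamma>)"
    unfolding refl_on_def carrier_\<Gamma> using ord_iff M_one nonzero_N ord_carrier by auto
  moreover have "trans (ord_rel \<Gamma>)"
  proof (rule transI)
    fix S T V assume *: "(S, T) \<in> ord_rel \<Gamma>" "(T, V) \<in> ord_rel \<Gamma>"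
    then obtain l m n where lmn: "l \<in> N" "m \<in> N" "n \<in> N" "S = cl l" "T = cl m" "V = cl n"
      using ord_carrier by (metis imageE)
    then have "inverse m * l \<in> M" "inverse n * m \<in> M" using * ord_iff by blast+
    then have "(inverse n * m) * (inverse m * l) \<in> M" using M_mult by blast
    moreover have "(inverse n * m) * (inverse m * l) = inverse n * (m * inverse m) * l" by (simp only: mult.assoc)
    ultimately show "(S, V) \<in> ord_rel \<Gamma>" using lmn ord_iff nonzero_N by simp
  qed
  moreover have "antisym (ord_rel \<Gamma>)"
  proof (rule antisymI)
    fix S T assume *: "(S, T) \<in> ord_rel \<Gamma>" "(T, S) \<in> ord_rel \<Gamma>"
    then obtain m n where mn: "m \<in> N" "n \<in> N" "S = cl m" "T = cl n"
      using ord_carrier by (metis imageE)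
    then have 1: "inverse n * m \<in> M" "inverse m * n \<in> M" using * ord_iff by blast+
    have "inverse (inverse m * n) = inverse n * m"
      using mn nonzero_N by (simp add: nonzero_inverse_mult_distrib)
    then show "S = T" using 1 mn cl_eq_iff unfolding U_def by auto
  qed
  moreover have "ord_rel \<Gamma> \<subseteq> carrier \<Gamma> \<times> carrier \<Gamma>" unfolding carrier_\<Gamma> using ord_carrier by auto
  ultimately show ?thesis unfolding partial_order_on_def preorder_on_def by blast
qed

lemma po_group_\<Gamma>: "po_group \<Gamma>"
  unfolding po_group_def
proof (intro conjI allI impI group_\<Gamma> partial_order_\<Gamma>, elim conjE)
  fix S T V W assume *: "(S, V) \<in> ord_rel \<Gamma>" "(T, W) \<in> ord_rel \<Gamma>"
  then obtain s v where sv: "s \<in> N" "v \<in> N" "S = cl s" "V = cl v"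
    using ord_carrier by blast
  from * obtain t w where tw: "t \<in> N" "w \<in> N" "T = cl t" "W = cl w"
    using ord_carrier by blast
  note d = sv(1) tw(1) sv(2) tw(2) sv(3,4) tw(3,4)
  have 1: "inverse v * s \<in> M" "inverse w * t \<in> M" using * ord_iff d by blast+
  have nz: "v \<noteq> 0" "w \<noteq> 0" using d nonzero_N by auto
  have "(inverse w * (inverse v * s) * w) * (inverse w * t) \<in> M"
    using M_mult[OF M_conj'[OF d(4) 1(1)] 1(2)] .
  moreover have "(inverse w * (inverse v * s) * w) * (inverse w * t) = inverse (v * w) * s * (w * inverse w) * t"
    unfolding nonzero_inverse_mult_distrib[OF nz] by (simp only: mult.assoc)
  ultimately have "inverse (v * w) * (s * t) \<in> M" using nz by (simp add: mult.assoc)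
  then show "(S \<otimes>\<^bsub>\<Gamma>\<^esub> T, V \<otimes>\<^bsub>\<Gamma>\<^esub> W) \<in> ord_rel \<Gamma>" using d cl_mult ord_iff mult_N by simp
qed

lemma hom_cl: "cl \<in> hom (mult_grp\<lparr>carrier := N\<rparr>) \<Gamma>"
  unfolding hom_def using cl_mult carrier_\<Gamma> by auto

lemma linear_order_\<Gamma>:
  assumes total: "\<And>t. t \<in> N \<Longrightarrow> t \<in> M \<or> inverse t \<in> M"
  shows "linear_order_on (carrier \<Gamma>) (ord_rel \<Gamma>)"
proof -
  have "(cl m, cl n) \<in> ord_rel \<Gamma> \<or> (cl n, cl m) \<in> ord_rel \<Gamma>" if mn: "m \<in> N" "n \<in> N" for m n
  proof -
    have "inverse (inverse n * m) = inverse m * n"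
      using mn nonzero_N by (simp add: nonzero_inverse_mult_distrib)
    then show ?thesis using total[OF mult_N[OF inverse_N[OF mn(2)] mn(1)]] ord_iff mn by auto
  qed
  then have "total_on (carrier \<Gamma>) (ord_rel \<Gamma>)" unfolding total_on_def carrier_\<Gamma> by blast
  then show ?thesis unfolding linear_order_on_def using partial_order_\<Gamma> by blast
qed

text \<open>In the order, \<open>inverse n * a \<in> M\<close> says that \<open>n\<close> is at
  least \<open>a\<close>, and \<open>inverse a * n \<notin> M\<close> makes this strict.\<close>

lemma s_levelI:
  assumes a: "a \<in> N" "inverse a \<in> M"
    and n: "n \<in> N" "inverse n * a \<in> M" "inverse a * n \<notin> M"
    and lev: "\<And>n. n \<in> N \<Longrightarrow> inverse n * a \<in> M \<Longrightarrow> inverse a * n \<notin> M \<Longrightarrow> 1 + n \<in> M \<and> 1 - n \<in> M"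
  shows "s_level N \<Gamma> cl (cl a)"
proof -
  have gt: "m \<in> N_gt N \<Gamma> cl (cl a) \<longleftrightarrow> m \<in> N \<and> inverse m * a \<in> M \<and> inverse a * m \<notin> M" for m
  proof -
    have "inverse (inverse m * a) = inverse a * m" if "m \<in> N"
      using a that nonzero_N by (simp add: nonzero_inverse_mult_distrib)
    then show ?thesis unfolding N_gt_def using ord_iff[OF a(1), of m] cl_eq_iff[of m a] a(1)
      by (auto simp: U_def)
  qed
  have le: "m \<in> N_le N \<Gamma> cl \<one>\<^bsub>\<Gamma>\<^esub>" if "m \<in> M" for m
    unfolding N_le_def one_\<Gamma> using that M_N ord_iff[of m 1] one_N by auto
  have "(\<one>\<^bsub>\<Gamma>\<^esub>, cl a) \<in> ord_rel \<Gamma>" unfolding one_\<Gamma> using ord_iff[OF one_N a(1)] a(2) by simp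
  moreover have "N_gt N \<Gamma> cl (cl a) \<noteq> {}" using gt n by blast
  ultimately show ?thesis unfolding s_level_def carrier_\<Gamma> using a(1) gt lev le by simp
qed

lemma s_level_one:
  assumes k: "k \<in> M" "inverse k \<notin> M"
    and lev: "\<And>n. n \<in> N \<Longrightarrow> n \<notin> M \<Longrightarrow> 1 - n \<in> M"
    and minus: "\<And>n. n \<in> M \<Longrightarrow> - n \<in> M"
  shows "s_level N \<Gamma> cl \<one>\<^bsub>\<Gamma>\<^esub>"
proof -
  have kN: "k \<in> N" "k \<noteq> 0" using k M_N nonzero_N by auto
  have "1 + n \<in> M" if "n \<in> N" "n \<notin> M" for n
    using lev[of "- n"] minus[of "- n"] minus_N that by auto
  then show ?thesis unfolding one_\<Gamma>
    using s_levelI[OF one_N _ inverse_N[OF kN(1)]] k M_one lev kN(2) by simp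
qed

text \<open>\<open>Q\<close> may be smaller than \<open>M\<close>, but multiplication by
  \<open>k\<close> takes \<open>M\<close> into \<open>Q\<close>. The level is
  \<open>inverse (k * k)\<close>: one factor \<open>k\<close> pays for the passage to
  \<open>Q\<close>, the other is the one in \<open>small\<close>.\<close>

lemma s_level_small:
  assumes Q: "Q \<subseteq> M" "\<And>u t. u \<in> N \<Longrightarrow> t \<in> Q \<Longrightarrow> u * t * inverse u \<in> Q"
    and k: "k \<in> Q" "inverse k \<notin> Q" "\<And>q. q \<in> M \<Longrightarrow> q * k \<in> Q"
    and small: "\<And>q. q \<in> Q \<Longrightarrow> 1 + inverse (k * q) \<in> Q \<and> 1 - inverse (k * q) \<in> Q"
  shows "\<exists>a. s_level N \<Gamma> cl a" and "inverse k \<notin> M"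
proof -
  have kM: "k \<in> M" using k(1) Q(1) by blast
  have kN: "k \<in> N" and k0: "k \<noteq> 0" using kM M_N nonzero_N by auto
  show ik: "inverse k \<notin> M"
  proof
    assume "inverse k \<in> M"
    then have "inverse k * inverse k * k \<in> Q" using M_mult k(3) by blast
    then show False using k(2) k0 by (simp add: mult.assoc)
  qed
  have cancel: "k * (inverse k * z) = z" for z using k0 by (simp add: mult.assoc[symmetric])
  have a: "inverse (k * k) \<in> N" "inverse (inverse (k * k)) \<in> M"
    using inverse_N[OF mult_N[OF kN kN]] M_mult[OF kM kM] k0 by auto
  have n: "inverse (k * k * k) \<in> N" using inverse_N mult_N kN by blast
  have 1: "inverse (inverse (k * k * k)) * inverse (k * k) \<in> M"
    "inverse (inverse (k * k)) * inverse (k * k * k) \<notin> M"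
  proof -
    have "inverse (inverse (k * k * k)) * inverse (k * k) = k"
      using k0 by (simp add: nonzero_inverse_mult_distrib mult.assoc cancel)
    then show "inverse (inverse (k * k * k)) * inverse (k * k) \<in> M" using kM by simp
    have "inverse (inverse (k * k)) * inverse (k * k * k) = inverse k"
      using k0 by (simp add: nonzero_inverse_mult_distrib mult.assoc cancel)
    then show "inverse (inverse (k * k)) * inverse (k * k * k) \<notin> M" using ik by simp
  qed
  have lev: "1 + n \<in> M \<and> 1 - n \<in> M" if nN: "n \<in> N" and n: "inverse n * inverse (k * k) \<in> M" for n
  proof -
    have n0: "n \<noteq> 0" using nN nonzero_N by blast
    define m where "m = inverse n * inverse (k * k)"
    have "m * k \<in> Q" using k(3) n unfolding m_def by blast
    \<comment> \<open>Conjugation by \<open>k\<close> brings one factor to the left, where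
      \<open>small\<close> has it.\<close>
    from Q(2)[OF inverse_N[OF kN] this] have q: "inverse k * (m * k) * k \<in> Q" using k0 by simp
    have "k * (inverse k * (m * k) * k) = m * (k * k)" using k0 by (simp add: mult.assoc[symmetric])
    also have "\<dots> = inverse n" unfolding m_def using k0 by (simp add: mult.assoc)
    finally have "inverse (k * (inverse k * (m * k) * k)) = n" using n0 by simp
    then show ?thesis using small[OF q] Q(1) by auto
  qed
  show "\<exists>a. s_level N \<Gamma> cl a" using s_levelI[OF a n 1 lev] by blast
qed

text \<open>Right multiplication by \<open>inverse h\<close>, for a lower bound \<open>h\<close> of
  a spanning list in \<open>N\<close>, makes the list nonnegative and keeps it spanning.\<close>

lemma basis_property_\<Gamma>:
  assumes cofinal: "\<And>F. finite F \<Longrightarrow> F \<subseteq> N \<Longrightarrow> \<exists>k\<in>N. \<forall>n\<in>F. k * inverse n \<in> M"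
  shows "basis_property N \<Gamma> cl"
  unfolding basis_property_def
proof (intro allI impI, elim conjE)
  fix k assume k: "subfield k (ring_of_type_algebra :: 'a ring)"
    and fd: "ring.finite_dimension (ring_of_type_algebra :: 'a ring) k UNIV"
  obtain us where us: "set us \<subseteq> N" "ring.Span ring_of_type_algebra k us = UNIV"
    using spanning_list_N[OF k fd] .
  obtain h where h: "h \<in> N" "\<And>n. n \<in> set us \<Longrightarrow> h * inverse n \<in> M"
    using cofinal[of "set us"] us(1) by auto
  have h0: "h \<noteq> 0" using h(1) nonzero_N by blast
  have "u * inverse h \<in> N_ge N \<Gamma> cl \<one>\<^bsub>\<Gamma>\<^esub>" if "u \<in> set us" for u
  proof -
    have u: "u \<in> N" "u \<noteq> 0" using that us(1) nonzero_N by auto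
    have uh: "u * inverse h \<in> N" using mult_N[OF u(1) inverse_N[OF h(1)]] .
    have "inverse (u * inverse h) = h * inverse u" using u h0 by (simp add: nonzero_inverse_mult_distrib)
    then show ?thesis unfolding N_ge_def one_\<Gamma> using ord_iff[OF one_N uh] uh h(2)[OF that] by simp
  qed
  moreover have "w \<in> ring.Span ring_of_type_algebra k (map (\<lambda>u. u * inverse h) us)" for w
  proof -
    have "w * h * inverse h \<in> ring.Span ring_of_type_algebra k (map (\<lambda>u. u * inverse h) us)"
      using Span_mult_right us(2) by blast
    then show ?thesis using h0 by (simp add: mult.assoc)
  qed
  ultimately show "contains_basis_over (N_ge N \<Gamma> cl \<one>\<^bsub>\<Gamma>\<^esub>) k"
    by (intro contains_basis_overI[OF k, of "map (\<lambda>u. u * inverse h) us"]) auto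
qed

end

section \<open>Leveled maps from far pairs of cosets\<close>

context far_pair
begin

text \<open>The sign is there because \<open>cone_total\<close> only puts \<open>- inverse t\<close>, and not \<open>inverse t\<close>,
  into the cone of \<open>x\<close>.\<close>

definition joint_cone :: "'a set" where
  "joint_cone = {t. \<exists>p\<in>cone (lcos x). \<exists>q\<in>cone (lcos y). t = p * q \<or> t = - (p * q)}"

lemma normal_cone_x: "normal_cone N (cone (lcos x))"
  by unfold_locales (use cone_subset cone_one cone_mult[OF x0] cone_conj[OF x0] in blast)+

lemma joint_cone_minus: "t \<in> joint_cone \<Longrightarrow> - t \<in> joint_cone"
  unfolding joint_cone_def by (auto; metis minus_minus)

lemma cone_subset_joint_cone: "cone (lcos x) \<subseteq> joint_cone" "cone (lcos y) \<subseteq> joint_cone"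
  unfolding joint_cone_def using cone_one by force+

lemma normal_cone_xy: "normal_cone N joint_cone"
proof unfold_locales
  show "joint_cone \<subseteq> N" unfolding joint_cone_def using cone_subset mult_N minus_N by blast
  show "1 \<in> joint_cone" using cone_subset_joint_cone(1) cone_one by blast
next
  have *: "p * q * (p' * q') \<in> joint_cone"
    if "p \<in> cone (lcos x)" "q \<in> cone (lcos y)" "p' \<in> cone (lcos x)" "q' \<in> cone (lcos y)" for p q p' q'
  proof -
    have q: "q \<in> N" "q \<noteq> 0" using that cone_subset nonzero_N by blast+
    \<comment> \<open>Conjugating \<open>p'\<close> by \<open>q\<close> brings the factors from the
      same cone together.\<close>
    have "(p * (q * p' * inverse q)) * (q * q') \<in> joint_cone"
      unfolding joint_cone_def using that cone_mult cone_conj x0 y0 q(1) by blast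
    moreover have "(p * (q * p' * inverse q)) * (q * q') = p * q * p' * (inverse q * q) * q'"
      by (simp only: mult.assoc)
    moreover have "\<dots> = p * q * (p' * q')" using q(2) by (simp add: mult.assoc)
    ultimately show ?thesis by (simp only:)
  qed
  fix s t assume "s \<in> joint_cone" "t \<in> joint_cone"
  then obtain p q p' q' where "p \<in> cone (lcos x)" "q \<in> cone (lcos y)" "p' \<in> cone (lcos x)" "q' \<in> cone (lcos y)"
    "s = p * q \<or> s = - (p * q)" "t = p' * q' \<or> t = - (p' * q')" unfolding joint_cone_def by blast
  then show "s * t \<in> joint_cone" using * joint_cone_minus by fastforce
next
  fix u t assume u: "u \<in> N" and "t \<in> joint_cone"
  then obtain p q where pq: "p \<in> cone (lcos x)" "q \<in> cone (lcos y)" "t = p * q \<or> t = - (p * q)"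
    unfolding joint_cone_def by blast
  have "u * p * inverse u \<in> cone (lcos x)" "u * q * inverse u \<in> cone (lcos y)"
    using cone_conj x0 y0 u pq by blast+
  then have 1: "(u * p * inverse u) * (u * q * inverse u) \<in> joint_cone" unfolding joint_cone_def by blast
  have "(u * p * inverse u) * (u * q * inverse u) = u * p * (inverse u * u) * q * inverse u"
    by (simp only: mult.assoc)
  also have "\<dots> = u * (p * q) * inverse u" using nonzero_N[OF u] by (simp add: mult.assoc)
  finally have "u * (p * q) * inverse u \<in> joint_cone" using 1 by (simp only:)
  then show "u * t * inverse u \<in> joint_cone" using pq(3) joint_cone_minus by fastforce
qed

lemma strongly_leveled:
  "\<exists>(\<Gamma> :: 'a set ordered_monoid) \<phi>. strongly_leveled_map N \<Gamma> \<phi> \<and> basis_property N \<Gamma> \<phi>"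
proof -
  interpret C: normal_cone N "cone (lcos x)" by (rule normal_cone_x)
  obtain k where k: "k \<in> cone (lcos x)" "inverse k \<notin> cone (lcos x)"
    "\<forall>q\<in>cone (lcos x). 1 + inverse (k * q) \<in> cone (lcos x) \<and> 1 - inverse (k * q) \<in> cone (lcos x)"
    by (rule small_element)
  have "\<exists>a. s_level N C.\<Gamma> C.cl a"
    by (rule C.s_level_small(1)[OF subset_refl cone_conj[OF x0] k(1,2)]) (use cone_mult[OF x0] k in blast)+
  then have "strongly_leveled_map N C.\<Gamma> C.cl"
    unfolding strongly_leveled_map_def using C.po_group_\<Gamma> C.hom_cl by blast
  moreover have "basis_property N C.\<Gamma> C.cl"
    by (rule C.basis_property_\<Gamma>) (use cone_cofinal in metis)
  ultimately show ?thesis by (intro exI conjI)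
qed

end

text \<open>The last clause is conditional so that one construction serves distances four and five;
  at distance five \<open>one_minus_N\<close> supplies its condition.\<close>

lemma (in far4_pair) strong_valuation_like:
  obtains \<Gamma> :: "'a set ordered_monoid" and \<phi> where
    "strong_valuation_like_map N \<Gamma> \<phi>" "basis_property N \<Gamma> \<phi>"
    "(\<And>t. t \<in> N \<Longrightarrow> t \<notin> cone (lcos x) \<Longrightarrow> t \<notin> cone (lcos y) \<Longrightarrow> 1 - t \<in> N) \<Longrightarrow> s_level N \<Gamma> \<phi> \<one>\<^bsub>\<Gamma>\<^esub>"
proof -
  interpret C: normal_cone N joint_cone by (rule normal_cone_xy)
  obtain k where k: "k \<in> cone (lcos x)" "inverse k \<notin> cone (lcos x)"
    "\<forall>q\<in>cone (lcos x). 1 + inverse (k * q) \<in> cone (lcos x) \<and> 1 - inverse (k * q) \<in> cone (lcos x)"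
    "\<forall>q\<in>cone (lcos y). q * k \<in> cone (lcos x) \<and> - (q * k) \<in> cone (lcos x)"
    using small_element by blast
  \<comment> \<open>Up to the factor \<open>k\<close>, the joint cone lies in the cone of
    \<open>x\<close>, so the level for \<open>x\<close> can be carried over.\<close>
  have Mk: "t * k \<in> cone (lcos x)" if "t \<in> joint_cone" for t
  proof -
    obtain p q where pq: "p \<in> cone (lcos x)" "q \<in> cone (lcos y)" "t = p * q \<or> t = - (p * q)"
      using \<open>t \<in> joint_cone\<close> unfolding joint_cone_def by blast
    then have "p * (q * k) \<in> cone (lcos x)" "p * - (q * k) \<in> cone (lcos x)" using k(4) cone_mult[OF x0] by blast+
    then show ?thesis using pq(3) by (auto simp: mult.assoc)
  qed
  note small = C.s_level_small[of "cone (lcos x)", OF cone_subset_joint_cone(1) cone_conj[OF x0] k(1,2) Mk k(3)[rule_format]]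
  have "t \<in> joint_cone \<or> inverse t \<in> joint_cone" if "t \<in> N" for t
    using cone_total[OF that] joint_cone_minus[of "- inverse t"] cone_subset_joint_cone by auto
  then have "strong_valuation_like_map N C.\<Gamma> C.cl"
    unfolding strong_valuation_like_map_def strongly_leveled_map_def
    using C.po_group_\<Gamma> C.hom_cl small(1) C.linear_order_\<Gamma> by blast
  moreover have "basis_property N C.\<Gamma> C.cl"
    by (rule C.basis_property_\<Gamma>) (use cone_cofinal cone_subset_joint_cone(1) in \<open>metis subsetD\<close>)
  moreover have "s_level N C.\<Gamma> C.cl \<one>\<^bsub>C.\<Gamma>\<^esub>"
    if one_minus: "\<And>t. t \<in> N \<Longrightarrow> t \<notin> cone (lcos x) \<Longrightarrow> t \<notin> cone (lcos y) \<Longrightarrow> 1 - t \<in> N"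
  proof (rule C.s_level_one[of k])
    fix n assume n: "n \<in> N" "n \<notin> joint_cone"
    then have "1 - n \<in> cone (lcos y)" using one_minus one_minus_cone cone_subset_joint_cone by blast
    then show "1 - n \<in> joint_cone" using cone_subset_joint_cone by blast
  qed (use k(1) small(2) cone_subset_joint_cone joint_cone_minus in blast)+
  ultimately show thesis by (rule that)
qed

section \<open>V-graphs\<close>

lemma gdist_le_iff: "gdist E u v \<le> enat k \<longleftrightarrow> (\<exists>n\<le>k. (u, v) \<in> E ^^ n)"
proof -
  have "gdist E u v \<le> enat k \<longleftrightarrow> gdist E u v < enat (Suc k)" by (cases "gdist E u v") auto
  also have "\<dots> \<longleftrightarrow> (\<exists>n\<in>{n. (u, v) \<in> E ^^ n}. enat n < enat (Suc k))"
    unfolding gdist_def by (rule INF_less_iff)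
  also have "\<dots> \<longleftrightarrow> (\<exists>n\<le>k. (u, v) \<in> E ^^ n)" by (auto simp: less_Suc_eq_le)
  finally show ?thesis .
qed

lemma gdist_triangle:
  assumes "gdist E u v \<le> enat i" "gdist E v w \<le> enat j"
  shows "gdist E u w \<le> enat (i + j)"
proof -
  obtain m n where "m \<le> i" "(u, v) \<in> E ^^ m" "n \<le> j" "(v, w) \<in> E ^^ n"
    using assms unfolding gdist_le_iff by blast
  then have "m + n \<le> i + j" "(u, w) \<in> E ^^ (m + n)" by (auto simp: relpow_add)
  then show ?thesis unfolding gdist_le_iff by blast
qed

lemma gdist_refl: "gdist E u u \<le> 1"
  using gdist_le_iff[of E u u 1] by (auto simp: one_enat_def intro!: exI[of _ 0])

lemma relpow_sym:
  assumes "sym E" "(u, v) \<in> E ^^ n"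
  shows "(v, u) \<in> E ^^ n"
  using assms(2)
proof (induction n arbitrary: v)
  case (Suc n)
  then obtain w where "(u, w) \<in> E ^^ n" "(w, v) \<in> E" by auto
  then have "(v, w) \<in> E" "(w, u) \<in> E ^^ n" using Suc.IH assms(1) by (auto dest: symD)
  then show ?case by (rule relpow_Suc_I2)
qed simp

lemma gdist_sym: "sym E \<Longrightarrow> gdist E u v = gdist E v u"
  unfolding gdist_def using relpow_sym[of E] by metis

text \<open>A supremum of extended naturals that exceeds \<open>k\<close>, finite or not, has a
  member exceeding \<open>k\<close>.\<close>

lemma gdiam_ge:
  assumes "gdiam V E \<ge> enat (Suc k)"
  obtains u v where "u \<in> V" "v \<in> V" "gdist E u v \<ge> enat (Suc k)"
proof -
  have "\<not> (\<forall>u\<in>V. \<forall>v\<in>V. gdist E u v \<le> enat k)"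
  proof
    assume "\<forall>u\<in>V. \<forall>v\<in>V. gdist E u v \<le> enat k"
    then have "gdiam V E \<le> enat k" unfolding gdiam_def by (auto intro!: SUP_least)
    then show False using assms order_trans by fastforce
  qed
  then obtain u v where "u \<in> V" "v \<in> V" "\<not> gdist E u v \<le> enat k" by blast
  then show thesis using that[of u v] by (cases "gdist E u v") auto
qed

section \<open>Passage from the quotient group to elements of \<open>D\<close>\<close>

lemma star_eq: "star N a = (*) a ` N" for a :: "'a::division_ring"
  unfolding l_coset_def by auto

lemma finite_index_normal_of_normal:
  fixes N :: "'a::division_ring set"
  assumes inf: "infinite (UNIV :: 'a set)" and N: "N \<lhd> mult_grp"
    and fin: "finite (carrier (mult_grp Mod N))" and m1: "- 1 \<in> N"
  shows "finite_index_normal N"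
proof -
  interpret G: group "mult_grp :: 'a monoid" by (rule group_mult_grp)
  interpret N: normal N mult_grp by (rule N)
  have N0: "0 \<notin> N" using N.subset carrier_mult_grp by blast
  have inv: "inv\<^bsub>mult_grp\<^esub> g = inverse g" if "g \<noteq> 0" for g :: 'a
    by (rule G.inv_equality) (use that in \<open>auto simp: carrier_mult_grp\<close>)
  show ?thesis
  proof
    show "1 \<in> N" using N.one_closed by simp
    show "m * n \<in> N" if "m \<in> N" "n \<in> N" for m n using N.m_closed[OF that] by simp
    show "inverse n \<in> N" if "n \<in> N" for n using N.m_inv_closed[OF that] inv that N0 by metis
    show "g * n * inverse g \<in> N" if "g \<noteq> 0" "n \<in> N" for g n
      using N.inv_op_closed2[of g n] inv that by (simp add: carrier_mult_grp)
    show "\<exists>R. finite R \<and> 0 \<notin> R \<and> (\<forall>g. g \<noteq> 0 \<longrightarrow> (\<exists>r\<in>R. inverse r * g \<in> N))"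
    proof (intro exI conjI allI impI)
      \<comment> \<open>Representatives are chosen from right cosets, which by normality are the
        left cosets of the claim.\<close>
      let ?R = "(\<lambda>C. SOME r. r \<in> C) ` carrier (mult_grp Mod N)"
      have cos: "N #>\<^bsub>mult_grp\<^esub> g \<in> carrier (mult_grp Mod N)" if "g \<noteq> 0" for g
        using that by (auto simp: FactGroup_def RCOSETS_def carrier_mult_grp)
      have mem: "(SOME r. r \<in> N #>\<^bsub>mult_grp\<^esub> g) \<in> (*) g ` N" if "g \<noteq> 0" for g
      proof -
        have "N #>\<^bsub>mult_grp\<^esub> g = (*) g ` N"
          using N.coset_eq that star_eq by (simp add: carrier_mult_grp)
        moreover have "g * 1 \<in> (*) g ` N" using N.one_closed by fastforce
        ultimately show ?thesis by (metis someI)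
      qed
      show "finite ?R" using fin by blast
      show "0 \<notin> ?R"
      proof
        assume "0 \<in> ?R"
        then obtain C where C: "C \<in> carrier (mult_grp Mod N)" "0 = (SOME r. r \<in> C)" by blast
        then obtain g where "g \<noteq> 0" "C = N #>\<^bsub>mult_grp\<^esub> g"
          unfolding FactGroup_def RCOSETS_def carrier_mult_grp by auto
        then have "0 = (SOME r. r \<in> N #>\<^bsub>mult_grp\<^esub> g)" using C(2) by simp
        then have "0 \<in> (*) g ` N" using mem[OF \<open>g \<noteq> 0\<close>] by simp
        then show False using N0 \<open>g \<noteq> 0\<close> by auto
      qed
      fix g :: 'a assume g: "g \<noteq> 0"
      then obtain n where n: "n \<in> N" "(SOME r. r \<in> N #>\<^bsub>mult_grp\<^esub> g) = g * n" using mem by blast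
      then have "n \<noteq> 0" using N0 by blast
      then have "inverse (g * n) * g = inverse n" using g by (simp add: nonzero_inverse_mult_distrib mult.assoc)
      moreover have "inverse n \<in> N" using N.m_inv_closed[OF n(1)] inv \<open>n \<noteq> 0\<close> by simp
      ultimately have "inverse (SOME r. r \<in> N #>\<^bsub>mult_grp\<^esub> g) * g \<in> N" using n(2) by simp
      then show "\<exists>r\<in>?R. inverse r * g \<in> N" using cos[OF g] by blast
    qed
  qed (use inf N0 m1 in auto)
qed

lemma near_relation_V_graph:
  fixes N :: "'a::division_ring set"
  assumes V: "V_graph N \<Delta>"
  shows "near_relation N (\<lambda>a b. gdist \<Delta> (star N a) (star N b) \<le> 1)"
proof -
  interpret finite_index_normal N
    by (rule finite_index_normal_of_normal) (use V[unfolded V_graph_def] in blast)+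
  have outside: "outside a \<longleftrightarrow> a \<in> carrier mult_grp - N" for a unfolding outside_def carrier_mult_grp by auto
  have star_mult: "star N (a * n) = star N a" if "n \<in> N" for a n
  proof -
    have "(*) n ` N = N"
    proof (intro equalityI subsetI)
      fix m assume "m \<in> N"
      then have "m = n * (inverse n * m)" "inverse n * m \<in> N"
        using that nonzero_N mult_N inverse_N by (auto simp: mult.assoc[symmetric])
      then show "m \<in> (*) n ` N" by blast
    qed (use that mult_N in auto)
    then show ?thesis unfolding star_eq by (metis (no_types, lifting) image_cong image_image mult.assoc)
  qed
  have prod: "star N a \<otimes>\<^bsub>quot N\<^esub> star N b = star N (a * b)" if "b \<noteq> 0" for a b
  proof -
    have "star N a \<otimes>\<^bsub>quot N\<^esub> star N b = {a * m * (b * n) | m n. m \<in> N \<and> n \<in> N}"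
      unfolding star_eq FactGroup_def set_mult_def by (simp, blast)
    also have "\<dots> = (*) (a * b) ` N"
    proof (intro equalityI subsetI)
      fix g assume "g \<in> {a * m * (b * n) | m n. m \<in> N \<and> n \<in> N}"
      then obtain m n where mn: "m \<in> N" "n \<in> N" "g = a * m * (b * n)" by blast
      have "g = a * (b * inverse b) * m * (b * n)" using mn(3) that by simp
      then have "g = a * b * ((inverse b * m * b) * n)" by (simp only: mult.assoc)
      then show "g \<in> (*) (a * b) ` N" using mult_N[OF conj_N'[OF that mn(1)] mn(2)] by blast
    next
      fix g assume "g \<in> (*) (a * b) ` N"
      then obtain n where "n \<in> N" "g = a * 1 * (b * n)" by (auto simp: mult.assoc)
      then show "g \<in> {a * m * (b * n) | m n. m \<in> N \<and> n \<in> N}" using one_N by blast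
    qed
    finally show ?thesis unfolding star_eq .
  qed
  show ?thesis
  proof
    show "gdist \<Delta> (star N a) (star N a) \<le> 1" for a by (rule gdist_refl)
    show "gdist \<Delta> (star N b) (star N a) \<le> 1" if "gdist \<Delta> (star N a) (star N b) \<le> 1" for a b
      using V that gdist_sym unfolding V_graph_def by metis
    show "gdist \<Delta> (star N (a * n)) (star N b) \<le> 1"
      if "gdist \<Delta> (star N a) (star N b) \<le> 1" "n \<in> N" for a b n using that star_mult by simp
    show "gdist \<Delta> (star N a) (star N b) \<le> 1" if "outside a" "outside b" "a - b \<in> N" for a b
      using V that unfolding V_graph_def outside by blast
    show "gdist \<Delta> (star N (inverse a)) (star N b) \<le> 1"
      if "outside a" "outside b" "gdist \<Delta> (star N a) (star N b) \<le> 1" for a b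
      using V that unfolding V_graph_def outside by blast
    show "gdist \<Delta> (star N b) (star N c) \<le> 1"
      if "outside a" "outside b" "outside c" "a * b \<notin> N" "gdist \<Delta> (star N a) (star N c) \<le> 1"
        "gdist \<Delta> (star N (a * b)) (star N c) \<le> 1" for a b c
    proof -
      have "b \<noteq> 0" using that(2) unfolding outside_def by blast
      then have "gdist \<Delta> (star N a \<otimes>\<^bsub>quot N\<^esub> star N b) (star N c) \<le> 1" using prod that(6) by simp
      then show ?thesis using V that unfolding V_graph_def outside by blast
    qed
  qed
qed

lemma V_verts_star:
  fixes N :: "'a::division_ring set"
  assumes "N \<lhd> mult_grp" "v \<in> V_verts N"
  obtains a where "a \<noteq> 0" "a \<notin> N" "v = star N a"
proof -
  interpret N: normal N mult_grp by (rule assms(1))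
  interpret G: group "mult_grp :: 'a monoid" by (rule group_mult_grp)
  obtain a where a: "a \<in> carrier mult_grp" "v = N #>\<^bsub>mult_grp\<^esub> a" "v \<noteq> N"
    using assms(2) unfolding V_verts_def by (auto simp: FactGroup_def RCOSETS_def)
  have "a \<notin> N" using a N.rcos_const[OF group_mult_grp] by blast
  moreover have "v = star N a" using a N.coset_eq by simp
  moreover have "a \<noteq> 0" using a(1) by (simp add: carrier_mult_grp)
  ultimately show thesis using that by blast
qed

lemma V_diam_ge:
  fixes N :: "'a::division_ring set"
  assumes V: "V_graph N \<Delta>" and "V_diam N \<Delta> \<ge> enat (Suc k)"
  obtains x y where "x \<noteq> 0" "x \<notin> N" "y \<noteq> 0" "y \<notin> N" "\<not> gdist \<Delta> (star N x) (star N y) \<le> enat k"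
proof -
  obtain u v where uv: "u \<in> V_verts N" "v \<in> V_verts N" "gdist \<Delta> u v \<ge> enat (Suc k)"
    using gdiam_ge assms(2) unfolding V_diam_def by metis
  have N: "N \<lhd> mult_grp" using V unfolding V_graph_def by blast
  have "\<not> gdist \<Delta> u v \<le> enat k" using uv(3) by (cases "gdist \<Delta> u v") auto
  then show thesis using V_verts_star[OF N uv(1)] V_verts_star[OF N uv(2)] that by metis
qed

theorem theoremB:
  fixes N :: "'a::division_ring set" and \<Delta> :: "'a set rel"
  assumes "infinite (UNIV :: 'a set)"
    and "N \<lhd> mult_grp"
    and "finite (carrier (mult_grp Mod N))"
    and "- 1 \<in> N"
    and "V_graph N \<Delta>"
  shows "(V_diam N \<Delta> \<ge> 3 \<longrightarrow>
            (\<exists>(\<Gamma> :: 'a set ordered_monoid) \<phi>.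
               strongly_leveled_map N \<Gamma> \<phi> \<and> basis_property N \<Gamma> \<phi>)) \<and>
         (V_diam N \<Delta> \<ge> 4 \<longrightarrow>
            (\<exists>(\<Gamma> :: 'a set ordered_monoid) \<phi>.
               strong_valuation_like_map N \<Gamma> \<phi> \<and> basis_property N \<Gamma> \<phi>)) \<and>
         (V_diam N \<Delta> \<ge> 5 \<longrightarrow>
            (\<exists>(\<Gamma> :: 'a set ordered_monoid) \<phi>.
               strong_valuation_like_map N \<Gamma> \<phi> \<and> s_level N \<Gamma> \<phi> \<one>\<^bsub>\<Gamma>\<^esub> \<and> basis_property N \<Gamma> \<phi>))"
proof -
  let ?A = "\<lambda>a b. gdist \<Delta> (star N a) (star N b) \<le> 1"
  interpret near_relation N ?A by (rule near_relation_V_graph[OF assms(5)])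
  \<comment> \<open>Each bound is written as a successor, because \<open>V_diam_ge\<close> turns the
    bound \<open>Suc k\<close> into the failure of \<open>k\<close>.\<close>
  have num: "(3::enat) = enat (Suc 2)" "(4::enat) = enat (Suc 3)" "(5::enat) = enat (Suc 4)" "(1::enat) = enat 1"
    by (simp_all add: numeral_eq_enat one_enat_def)
  note tri = gdist_triangle[where E = \<Delta>]
  have far3: "far_pair N ?A x y" if "outside x" "outside y" "\<not> gdist \<Delta> (star N x) (star N y) \<le> enat 2" for x y
  proof
    fix c assume "?A x c" "?A c y"
    then show False using tri[of "star N x" "star N c" 1 "star N y" 1] that(3)
      unfolding num by (simp add: numeral_2_eq_2)
  qed (use that in auto)
  have far4: "far4_pair N ?A x y" if "outside x" "outside y" "\<not> gdist \<Delta> (star N x) (star N y) \<le> enat 3" for x y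
  proof -
    have "\<not> gdist \<Delta> (star N x) (star N y) \<le> enat 2"
      using that(3) by (cases "gdist \<Delta> (star N x) (star N y)") auto
    then interpret far_pair N ?A x y using far3 that by blast
    show ?thesis
    proof
      fix c d assume "?A x c" "?A c d" "?A d y"
      then show False using tri[OF tri[of "star N x" "star N c" 1 "star N d" 1], of "star N y" 1] that(3)
        unfolding num by (simp add: numeral_3_eq_3)
    qed
  qed
  have far5: "far5_pair N ?A x y" if "outside x" "outside y" "\<not> gdist \<Delta> (star N x) (star N y) \<le> enat 4" for x y
  proof -
    have "\<not> gdist \<Delta> (star N x) (star N y) \<le> enat 3"
      using that(3) by (cases "gdist \<Delta> (star N x) (star N y)") auto
    then interpret far4_pair N ?A x y using far4 that by blast
    show ?thesis
    proof
      fix c d e assume "?A x c" "?A c d" "?A d e" "?A e y"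
      then show False
        using tri[OF tri[of "star N x" "star N c" 1 "star N d" 1] tri[of "star N d" "star N e" 1 "star N y" 1]] that(3)
        unfolding num by (simp add: eval_nat_numeral)
    qed
  qed
  show ?thesis
  proof (intro conjI impI)
    assume "V_diam N \<Delta> \<ge> 3"
    then obtain x y where "outside x" "outside y" "\<not> gdist \<Delta> (star N x) (star N y) \<le> enat 2"
      using V_diam_ge[OF assms(5), of 2] unfolding num outside_def by metis
    then interpret far_pair N ?A x y using far3 by blast
    show "\<exists>(\<Gamma> :: 'a set ordered_monoid) \<phi>. strongly_leveled_map N \<Gamma> \<phi> \<and> basis_property N \<Gamma> \<phi>"
      by (rule strongly_leveled)
  next
    assume "V_diam N \<Delta> \<ge> 4"
    then obtain x y where "outside x" "outside y" "\<not> gdist \<Delta> (star N x) (star N y) \<le> enat 3"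
      using V_diam_ge[OF assms(5), of 3] unfolding num outside_def by metis
    then interpret far4_pair N ?A x y using far4 by blast
    show "\<exists>(\<Gamma> :: 'a set ordered_monoid) \<phi>. strong_valuation_like_map N \<Gamma> \<phi> \<and> basis_property N \<Gamma> \<phi>"
      using strong_valuation_like by metis
  next
    assume "V_diam N \<Delta> \<ge> 5"
    then obtain x y where "outside x" "outside y" "\<not> gdist \<Delta> (star N x) (star N y) \<le> enat 4"
      using V_diam_ge[OF assms(5), of 4] unfolding num outside_def by metis
    then interpret far5_pair N ?A x y using far5 by blast
    show "\<exists>(\<Gamma> :: 'a set ordered_monoid) \<phi>.
      strong_valuation_like_map N \<Gamma> \<phi> \<and> s_level N \<Gamma> \<phi> \<one>\<^bsub>\<Gamma>\<^esub> \<and> basis_property N \<Gamma> \<phi>"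
      using strong_valuation_like one_minus_N by metis
  qed
qed

end
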